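(* Let $\mathcal{H}$ be a complex separable infinite-dimensional Hilbert space and $T$ a bounded linear operator on $\mathcal{H}$ whose eigenvectors associated to unimodular eigenvalues are parametrized by a $\mu$-spanning $\mathbb{T}$-eigenvector field $E$, and let $m$ be the associated Gaussian measure. Then for every sequence $(s_n)_{n\in\mathbb{N}}$ of positive real numbers tending to zero there exists a function $f\in\mathcal{G}_{\mathbb{C}}$ such that $$|\mathcal{I}_n(\overline{f},f)|\ge s_n$$ for every positive integer $n$, where $\overline{f}$ is the function $x\mapsto\overline{f(x)}$.
   Context: The inner product of $\mathcal{H}$ is linear in the second variable and conjugate-linear in the first. $\mathbb{T}$ is the unit circle, $\mu$ normalized Lebesgue measure on it. A $\mathbb{T}$-eigenvector field is a bounded map $E:\mathbb{T}\to\mathcal{H}$ with $TE(\lambda)=\lambda E(\lambda)$ for all $\lambda$; it is $\mu$-spanning if for every measurable $A\subset\mathbb{T}$ with $\mu(A)=1$ the vectors $E(\lambda)$, $\lambda\in A$, span a dense subspace. Let $R$ be the operator with $\langle Rx,y\rangle=\int_{\mathbb{T}}\langle x,E(\lambda)\rangle\overline{\langle y,E(\lambda)\rangle}\,d\mu(\lambda)$, and $m$ the Gaussian measure on $\mathcal{H}$ with covariance $R$: the Borel probability measure such that each $\langle x,\cdot\rangle$ has complex symmetric Gaussian distribution and $\int\langle x,z\rangle\overline{\langle y,z\rangle}\,dm(z)=\langle Rx,y\rangle$. $\mathcal{I}_n(f,g)=\int f(T^nx)g(x)\,dm(x)-\int f\,dm\int g\,dm$. Let $(e_k)_{k\ge1}$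 be an orthonormal basis of $\mathcal{H}$ consisting of eigenvectors of $R$; $\mathcal{G}_{\mathbb{C}}$ is the closed linear span in $L^2(\mathcal{H},\mathcal{B},m)$ of the functions $\langle e_k,\cdot\rangle$, $k\ge1$. *)

theory Defs
  imports "HOL-Analysis.Analysis" "HOL-Probability.Probability"
begin

class complex_hilbert = banach +
  fixes cscale :: "complex \<Rightarrow> 'a \<Rightarrow> 'a"
    and cinner :: "'a \<Rightarrow> 'a \<Rightarrow> complex"
  assumes cscale_of_real: "cscale (complex_of_real r) x = scaleR r x"
    and cscale_add_right: "cscale a (x + y) = cscale a x + cscale a y"
    and cscale_add_left: "cscale (a + b) x = cscale a x + cscale b x"
    and cscale_cscale: "cscale a (cscale b x) = cscale (a * b) x"
    and cinner_add_right: "cinner x (y + z) = cinner x y + cinner x z"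
    and cinner_cscale_right: "cinner x (cscale a y) = a * cinner x y"
    and cinner_commute: "cinner y x = cnj (cinner x y)"
    and cinner_self_norm: "cinner x x = complex_of_real ((norm x)\<^sup>2)"

definition cspan :: "'a::complex_hilbert set \<Rightarrow> 'a set" where
  "cspan A = {(\<Sum>v\<in>S. cscale (c v) v) | S c. finite S \<and> S \<subseteq> A}"

definition separable_space :: "'a::complex_hilbert itself \<Rightarrow> bool" where
  "separable_space _ \<longleftrightarrow> (\<exists>D::'a set. countable D \<and> closure D = UNIV)"

definition infinite_dimensional :: "'a::complex_hilbert itself \<Rightarrow> bool" where
  "infinite_dimensional _ \<longleftrightarrow> \<not> (\<exists>F::'a set. finite F \<and> cspan F = UNIV)"

definition bounded_clinear_op :: "('a::complex_hilbert \<Rightarrow> 'a) \<Rightarrow> bool" where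
  "bounded_clinear_op T \<longleftrightarrow>
     (\<forall>x y. T (x + y) = T x + T y) \<and> (\<forall>a x. T (cscale a x) = cscale a (T x)) \<and>
     (\<exists>K. \<forall>x. norm (T x) \<le> norm x * K)"

definition circle_measure :: "complex measure" where
  "circle_measure = distr (uniform_measure lborel {0..<2*pi}) borel cis"

definition circle :: "complex set" where
  "circle = {l. cmod l = 1}"

definition T_eigenvector_field :: "('a::complex_hilbert \<Rightarrow> 'a) \<Rightarrow> (complex \<Rightarrow> 'a) \<Rightarrow> bool" where
  "T_eigenvector_field T E \<longleftrightarrow>
     (\<exists>C. \<forall>l\<in>circle. norm (E l) \<le> C) \<and>
     (\<forall>l\<in>circle. T (E l) = cscale l (E l))"

definition mu_spanning :: "(complex \<Rightarrow> 'a::complex_hilbert) \<Rightarrow> bool" where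
  "mu_spanning E \<longleftrightarrow>
     (\<forall>A. A \<in> sets circle_measure \<and> A \<subseteq> circle \<and> measure circle_measure A = 1
          \<longrightarrow> closure (cspan (E ` A)) = UNIV)"

text \<open>Complex symmetric (circular) Gaussian law on \<open>\<complex>\<close> with \<open>E|Z|^2 = v\<close>:
real and imaginary parts independent centred normal with variance \<open>v/2\<close>
(the Dirac mass at 0 when \<open>v = 0\<close>).\<close>

definition complex_gaussian :: "real \<Rightarrow> complex measure" where
  "complex_gaussian v =
     (if v = 0 then return borel 0
      else distr (density lborel (normal_density 0 (sqrt (v / 2))) \<Otimes>\<^sub>M
                  density lborel (normal_density 0 (sqrt (v / 2))))
                 borel (\<lambda>(a, b). Complex a b))"

definition gaussian_measure_with_cov :: "'a::complex_hilbert measure \<Rightarrow> ('a \<Rightarrow> 'a) \<Rightarrow> bool" where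
  "gaussian_measure_with_cov m R \<longleftrightarrow>
     prob_space m \<and> sets m = sets borel \<and>
     (\<forall>x. distr m borel (cinner x) = complex_gaussian (Re (cinner (R x) x))) \<and>
     (\<forall>x y. (\<integral>z. cinner x z * cnj (cinner y z) \<partial>m) = cinner (R x) y)"

definition I_n :: "'a measure \<Rightarrow> ('a \<Rightarrow> 'a) \<Rightarrow> nat \<Rightarrow> ('a \<Rightarrow> complex) \<Rightarrow> ('a \<Rightarrow> complex) \<Rightarrow> complex" where
  "I_n m T n f g = (\<integral>x. f ((T ^^ n) x) * g x \<partial>m) - (\<integral>x. f x \<partial>m) * (\<integral>x. g x \<partial>m)"

definition gauss_span :: "(nat \<Rightarrow> 'a::complex_hilbert) \<Rightarrow> ('a \<Rightarrow> complex) set" where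
  "gauss_span e = {(\<lambda>x. \<Sum>k\<in>S. c k * cinner (e k) x) | S c. finite S \<and> S \<subseteq> {1..}}"

text \<open>\<open>G_C\<close>: functions (representatives of elements of \<open>L^2(m)\<close>) lying in the
\<open>L^2(m)\<close>-closure of \<open>gauss_span e\<close>.\<close>
definition G_C :: "'a::complex_hilbert measure \<Rightarrow> (nat \<Rightarrow> 'a) \<Rightarrow> ('a \<Rightarrow> complex) set" where
  "G_C m e = {f. f \<in> borel_measurable m \<and> integrable m (\<lambda>x. (cmod (f x))\<^sup>2) \<and>
     (\<exists>g. (\<forall>n. g n \<in> gauss_span e) \<and>
          (\<lambda>n. \<integral>x. (cmod (f x - g n x))\<^sup>2 \<partial>m) \<longlonglongrightarrow> 0)}"

definition orthonormal_basis :: "(nat \<Rightarrow> 'a::complex_hilbert) \<Rightarrow> bool" where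
  "orthonormal_basis e \<longleftrightarrow>
     (\<forall>i\<ge>1. \<forall>j\<ge>1. cinner (e i) (e j) = (if i = j then 1 else 0)) \<and>
     closure (cspan (e ` {1..})) = UNIV"

end

theory Submission
  imports Defs
begin

text \<open>The map \<open>\<langle>y, \<cdot>\<rangle> \<mapsto> \<langle>y, E(\<cdot>)\<rangle>\<close> is an isometry from \<open>L\<^sup>2(m)\<close> to \<open>L\<^sup>2(\<mu>)\<close> which turns
  composition with \<open>T\<close> into multiplication by \<open>\<lambda>\<close>, so for \<open>f = \<langle>y, \<cdot>\<rangle>\<close> the correlation of \<open>cnj f\<close> and \<open>f\<close>
  is the \<open>n\<close>-th Fourier coefficient of \<open>\<bar>\<langle>y, E\<rangle>\<bar>\<^sup>2\<close>. Fix \<open>x\<close> with \<open>\<phi> = \<langle>x, E\<rangle>\<close> not a.e. zero and put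
  \<open>w = \<bar>\<phi>\<bar>\<^sup>2\<close>; polynomials in the adjoint of \<open>T\<close> applied to \<open>x\<close> realise every function \<open>P \<phi>\<close> with \<open>P\<close> an
  analytic polynomial. Choosing the centres by averaging over rotations and compactness, there are
  normalised square roots \<open>u\<^sub>i\<close> of Fejer kernels for which \<open>\<bar>u\<^sub>i\<bar>\<^sup>2 w\<close> converges weakly to a positive
  multiple of a point mass, so each fixed Fourier coefficient tends in modulus to a constant \<open>\<alpha> > 0\<close>,
  while \<open>u\<^sub>i\<close> tends to zero in \<open>L\<^sup>1\<close>, so cross terms become negligible uniformly in \<open>n\<close>. Taking
  \<open>P = \<Sum>k a\<^sub>k u\<^bsub>i(k)\<^esub>\<close> with \<open>a\<^sub>k\<close> comparable to \<open>1/k\<^sup>2\<close> and \<open>i(k)\<close> growing fast enough, the Fourier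
  coefficients in the \<open>k\<close>-th block of indices are governed by the tail \<open>\<Sum>j>k a\<^sub>j\<^sup>2\<close>, which dominates the
  single transitional term \<open>a\<^sub>k\<^sup>2\<close>; by the Riemann-Lebesgue lemma the blocks may be started as late as desired.\<close>

section \<open>Complex Hilbert spaces\<close>

lemma cscale_zero_right [simp]: "cscale a (0::'a::complex_hilbert) = 0"
  using cscale_add_right[of a 0 0] by simp

lemma cinner_zero_right [simp]: "cinner x (0::'a::complex_hilbert) = 0"
  using cinner_add_right[of x 0 0] by simp

lemma cinner_add_left: "cinner (x + y) (z::'a::complex_hilbert) = cinner x z + cinner y z"
  by (subst (1 2 3) cinner_commute) (simp add: cinner_add_right)

lemma cinner_cscale_left: "cinner (cscale a x) (y::'a::complex_hilbert) = cnj a * cinner x y"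
  by (subst (1 2) cinner_commute) (simp add: cinner_cscale_right)

lemma cinner_scaleR_right: "cinner x (r *\<^sub>R (y::'a::complex_hilbert)) = r *\<^sub>R cinner x y"
  by (metis cinner_cscale_right cscale_of_real scaleR_conv_of_real)

lemma cinner_scaleR_left: "cinner (r *\<^sub>R x) (y::'a::complex_hilbert) = r *\<^sub>R cinner x y"
  by (metis cinner_cscale_left cscale_of_real scaleR_conv_of_real complex_cnj_complex_of_real)

lemma cinner_minus_left: "cinner (- x) (y::'a::complex_hilbert) = - cinner x y"
  using cinner_scaleR_left[of "-1" x y] by simp

lemma cinner_minus_right: "cinner x (- (y::'a::complex_hilbert)) = - cinner x y"
  using cinner_scaleR_right[of x "-1" y] by simp

lemma cinner_diff_left: "cinner (x - y) (z::'a::complex_hilbert) = cinner x z - cinner y z"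
  using cinner_add_left[of x "-y" z] by (simp add: cinner_minus_left)

lemma cinner_diff_right: "cinner x (y - (z::'a::complex_hilbert)) = cinner x y - cinner x z"
  using cinner_add_right[of x y "-z"] by (simp add: cinner_minus_right)

lemma cinner_Cauchy_Schwarz: "cmod (cinner x y) \<le> norm x * norm (y::'a::complex_hilbert)"
proof (cases "y = 0")
  case False
  define b where "b = cinner y x"
  define r where "r = (norm y)\<^sup>2"
  have xy: "cinner x y = cnj b" unfolding b_def by (rule cinner_commute)
  have yy: "cinner y y = of_real r" unfolding r_def by (rule cinner_self_norm)
  \<comment> \<open>The vector expanded here is \<open>r\<close> times the component of
    \<open>x\<close> orthogonal to \<open>y\<close>; nonnegativity of its squared norm is the
    inequality.\<close>
  have "cinner (r *\<^sub>R x - cscale b y) (r *\<^sub>R x - cscale b y)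
      = of_real (r * r) * cinner x x - of_real r * (b * cnj b)"
    by (simp add: cinner_diff_left cinner_diff_right cinner_scaleR_left cinner_scaleR_right
        cinner_cscale_left cinner_cscale_right xy yy b_def[symmetric] scaleR_conv_of_real algebra_simps)
  also have "\<dots> = of_real (r * (r * (norm x)\<^sup>2 - (cmod b)\<^sup>2))"
    by (simp add: cinner_self_norm complex_norm_square[symmetric] algebra_simps)
  finally have "r * (r * (norm x)\<^sup>2 - (cmod b)\<^sup>2) = (norm (r *\<^sub>R x - cscale b y))\<^sup>2"
    unfolding cinner_self_norm using of_real_eq_iff by metis
  then have "0 \<le> r * (r * (norm x)\<^sup>2 - (cmod b)\<^sup>2)" by simp
  moreover have "r > 0" using False by (simp add: r_def)
  ultimately have "(cmod b)\<^sup>2 \<le> (norm x * norm y)\<^sup>2"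
    by (simp add: zero_le_mult_iff r_def power_mult_distrib mult.commute)
  then have "cmod b \<le> norm x * norm y" by (rule power2_le_imp_le) simp
  then show ?thesis by (simp add: xy)
qed simp

lemma bounded_bilinear_cinner: "bounded_bilinear (cinner :: 'a::complex_hilbert \<Rightarrow> 'a \<Rightarrow> complex)"
proof
  show "\<exists>K. \<forall>a b::'a. norm (cinner a b) \<le> norm a * norm b * K"
    using cinner_Cauchy_Schwarz by (metis mult.right_neutral)
qed (simp_all add: cinner_add_left cinner_add_right cinner_scaleR_left cinner_scaleR_right)

lemmas cinner_sum_left = bounded_bilinear.sum_left[OF bounded_bilinear_cinner]
lemmas cinner_sum_right = bounded_bilinear.sum_right[OF bounded_bilinear_cinner]
lemmas tendsto_cinner = bounded_bilinear.tendsto[OF bounded_bilinear_cinner]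

lemma continuous_on_cinner: "continuous_on A (cinner (x::'a::complex_hilbert))"
  by (intro bounded_bilinear.continuous_on[OF bounded_bilinear_cinner] continuous_intros)

lemma borel_measurable_cinner [measurable]: "cinner (x::'a::complex_hilbert) \<in> borel_measurable borel"
  by (intro borel_measurable_continuous_onI continuous_on_cinner)

lemma cinner_eq_0_closure_cspan:
  assumes "closure (cspan A) = UNIV" "\<And>a. a \<in> A \<Longrightarrow> cinner x a = 0"
  shows "cinner x (y::'a::complex_hilbert) = 0"
proof -
  have "closure (cspan A) \<subseteq> {y. cinner x y = 0}"
  proof (rule closure_minimal)
    show "cspan A \<subseteq> {y. cinner x y = 0}"
      using assms(2) by (auto 4 4 simp: cspan_def cinner_sum_right cinner_cscale_right intro!: sum.neutral)
    have "closed (cinner x -` {0})"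
      by (rule closed_vimage) (auto simp: continuous_on_cinner)
    then show "closed {y. cinner x y = 0}" by (simp add: vimage_def)
  qed
  then show ?thesis using assms(1) by auto
qed

section \<open>Orthonormal expansions and the adjoint\<close>

lemma norm_sum_orthonormal:
  fixes b :: "nat \<Rightarrow> 'a::complex_hilbert"
  assumes "finite S" "\<And>i j. i \<in> S \<Longrightarrow> j \<in> S \<Longrightarrow> cinner (b i) (b j) = (if i = j then 1 else 0)"
  shows "(norm (\<Sum>i\<in>S. cscale (c i) (b i)))\<^sup>2 = (\<Sum>i\<in>S. (cmod (c i))\<^sup>2)"
proof -
  have "cinner (\<Sum>i\<in>S. cscale (c i) (b i)) (\<Sum>i\<in>S. cscale (c i) (b i))
     = (\<Sum>i\<in>S. \<Sum>j\<in>S. cnj (c i) * (c j * cinner (b i) (b j)))"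
    unfolding cinner_sum_left by (simp add: cinner_sum_right cinner_cscale_left cinner_cscale_right sum_distrib_left ac_simps)
  also have "\<dots> = (\<Sum>i\<in>S. \<Sum>j\<in>S. if i = j then c i * cnj (c i) else 0)"
    by (intro sum.cong refl) (auto simp: assms(2))
  also have "\<dots> = of_real (\<Sum>i\<in>S. (cmod (c i))\<^sup>2)"
    using assms(1) by (simp add: complex_norm_square del: of_real_power)
  finally show ?thesis unfolding cinner_self_norm using of_real_eq_iff by blast
qed

text \<open>Built from the basis expansion \<open>y = \<Sum>k cnj \<langle>x, T e\<^sub>k\<rangle> e\<^sub>k\<close>, which avoids the Riesz
  representation theorem.\<close>

lemma adjoint_exists:
  fixes T :: "'a::complex_hilbert \<Rightarrow> 'a" and e :: "nat \<Rightarrow> 'a"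
  assumes T: "bounded_clinear_op T" and e: "orthonormal_basis e"
  obtains S :: "'a \<Rightarrow> 'a" where "\<And>x z. cinner (S x) z = cinner x (T z)"
proof -
  from T obtain K where Tadd: "\<And>x y. T (x + y) = T x + T y"
    and Tsc: "\<And>a x. T (cscale a x) = cscale a (T x)" and K: "\<And>x. norm (T x) \<le> norm x * K"
    by (auto simp: bounded_clinear_op_def)
  have T0: "T 0 = 0" using Tadd[of 0 0] by simp
  have Tsum: "T (\<Sum>i\<in>A. g i) = (\<Sum>i\<in>A. T (g i))" if "finite A" for A and g :: "nat \<Rightarrow> 'a"
    using that by (induction A rule: finite_induct) (auto simp: Tadd T0)
  have Tbl: "bounded_linear T"
    by (rule bounded_linear_intro[of _ K])
       (auto simp: Tadd K cscale_of_real[symmetric] Tsc)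
  \<comment> \<open>The basis is indexed from 1; after the shift, partial sums run over initial
    segments of the naturals.\<close>
  define b where "b k = e (Suc k)" for k
  have on: "cinner (b i) (b j) = (if i = j then 1 else 0)" for i j
    using e by (auto simp: b_def orthonormal_basis_def)
  have rb: "range b = e ` {1..}"
    by (force simp: b_def Suc_le_eq dest: gr0_implies_Suc)
  have ex: "\<exists>y. \<forall>z. cinner y z = cinner x (T z)" for x
  proof -
    define c where "c k = cnj (cinner x (T (b k)))" for k
    define y where "y S = (\<Sum>i\<in>S. cscale (c i) (b i))" for S
    \<comment> \<open>Testing the functional on \<open>y S\<close> itself gives ||y S||^2 = |<x, T
      (y S)>|, which is at most K ||x|| ||y S||. Cancelling one factor bounds every finite sum of
      squared coefficients.\<close>
    have bound: "(\<Sum>i\<in>S. (cmod (c i))\<^sup>2) \<le> (norm x * K)\<^sup>2" if S: "finite S" for S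
    proof -
      have ny: "(norm (y S))\<^sup>2 = (\<Sum>i\<in>S. (cmod (c i))\<^sup>2)"
        unfolding y_def by (rule norm_sum_orthonormal) (auto simp: S on)
      have "cinner x (T (y S)) = (\<Sum>i\<in>S. c i * cnj (c i))"
        by (simp add: y_def Tsum[OF S] Tsc cinner_sum_right cinner_cscale_right c_def)
      also have "\<dots> = of_real ((norm (y S))\<^sup>2)"
        by (simp add: ny complex_norm_square del: of_real_power)
      finally have "(norm (y S))\<^sup>2 = cmod (cinner x (T (y S)))" by (simp add: norm_power)
      also have "\<dots> \<le> norm x * (norm (y S) * K)"
        by (rule order_trans[OF cinner_Cauchy_Schwarz]) (auto intro: mult_left_mono K)
      finally have le: "norm (y S) * norm (y S) \<le> norm (y S) * (norm x * K)"
        by (simp add: power2_eq_square algebra_simps)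
      have "norm (y S) \<le> norm x * K \<or> norm (y S) = 0"
        using le by (cases "norm (y S) = 0") simp_all
      then have "(norm (y S))\<^sup>2 \<le> (norm x * K)\<^sup>2"
        by (auto intro: power_mono)
      with ny show ?thesis by simp
    qed
    have sm: "summable (\<lambda>i. (cmod (c i))\<^sup>2)"
      by (rule bounded_imp_summable[where B="(norm x * K)\<^sup>2"]) (auto intro: bound)
    have "Cauchy (\<lambda>n. \<Sum>i<n. cscale (c i) (b i))"
    proof (rule CauchyI)
      fix r :: real assume "r > 0"
      then have "r\<^sup>2 > 0" by simp
      with sm obtain N where N: "\<And>m n. m \<ge> N \<Longrightarrow> norm (\<Sum>i\<in>{m..<n}. (cmod (c i))\<^sup>2) < r\<^sup>2"
        unfolding summable_Cauchy by blast
      have *: "norm ((\<Sum>i<n. cscale (c i) (b i)) - (\<Sum>i<m. cscale (c i) (b i))) < r"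
        if "N \<le> m" "m \<le> n" for m n
      proof -
        have "(\<Sum>i<n. cscale (c i) (b i)) - (\<Sum>i<m. cscale (c i) (b i)) = y {m..<n}"
          using that by (simp add: y_def sum_diff_nat_ivl flip: atLeast0LessThan)
        moreover have "(norm (y {m..<n}))\<^sup>2 = (\<Sum>i\<in>{m..<n}. (cmod (c i))\<^sup>2)"
          unfolding y_def by (rule norm_sum_orthonormal) (auto simp: on)
        moreover have "\<dots> < r\<^sup>2" using N[OF that(1), of n] by simp
        ultimately show ?thesis using \<open>r > 0\<close> by (auto intro: power2_less_imp_less)
      qed
      show "\<exists>M. \<forall>m\<ge>M. \<forall>n\<ge>M. norm ((\<Sum>i<m. cscale (c i) (b i)) - (\<Sum>i<n. cscale (c i) (b i))) < r"
      proof (intro exI allI impI)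
        fix m n assume mn: "m \<ge> N" "n \<ge> N"
        show "norm ((\<Sum>i<m. cscale (c i) (b i)) - (\<Sum>i<n. cscale (c i) (b i))) < r"
        proof (cases "m \<le> n")
          case True
          then show ?thesis using *[OF mn(1) True] by (simp only: norm_minus_commute)
        next
          case False
          then show ?thesis using *[OF mn(2), of m] by simp
        qed
      qed
    qed
    then obtain l where l: "(\<lambda>n. \<Sum>i<n. cscale (c i) (b i)) \<longlonglongrightarrow> l"
      using Cauchy_convergent convergent_def by blast
    have lb: "cinner l (b k) = cinner x (T (b k))" for k
    proof -
      have "(\<lambda>n. cinner (\<Sum>i<n. cscale (c i) (b i)) (b k)) \<longlonglongrightarrow> cinner l (b k)"
        by (intro tendsto_cinner l tendsto_const)
      moreover have "eventually (\<lambda>n. cinner (\<Sum>i<n. cscale (c i) (b i)) (b k) = cinner x (T (b k))) sequentially"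
        using eventually_gt_at_top[of k]
        by eventually_elim (simp add: cinner_sum_left cinner_cscale_left on if_distrib c_def cong: if_cong)
      ultimately show ?thesis by (rule LIMSEQ_unique[OF _ tendsto_eventually])
    qed
    \<comment> \<open>Both sides are continuous and linear in \<open>z\<close> and agree on the
      basis, hence everywhere by density.\<close>
    have "closure (cspan (e ` {1..})) \<subseteq> {z. cinner l z = cinner x (T z)}"
    proof (rule closure_minimal)
      show "cspan (e ` {1..}) \<subseteq> {z. cinner l z = cinner x (T z)}"
      proof
        fix z assume "z \<in> cspan (e ` {1..})"
        then obtain S d where S: "finite S" "S \<subseteq> range b" and z: "z = (\<Sum>v\<in>S. cscale (d v) v)"
          unfolding cspan_def rb[symmetric] by blast
        have Tz: "T z = (\<Sum>v\<in>S. cscale (d v) (T v))"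
          unfolding z linear_sum[OF bounded_linear.linear[OF Tbl]] by (simp add: Tsc)
        show "z \<in> {z. cinner l z = cinner x (T z)}"
          using S(2) lb unfolding mem_Collect_eq Tz
          by (auto simp: z cinner_sum_right cinner_cscale_right intro!: sum.cong)
      qed
      have "continuous_on UNIV (\<lambda>z. cinner l z - cinner x (T z))"
        by (intro continuous_intros continuous_on_cinner
            continuous_on_compose2[OF continuous_on_cinner[of UNIV]] bounded_linear.continuous_on[OF Tbl]) auto
      then have "closed ((\<lambda>z. cinner l z - cinner x (T z)) -` {0})"
        by (intro closed_vimage) auto
      then show "closed {z. cinner l z = cinner x (T z)}" by (simp add: vimage_def)
    qed
    then have "\<forall>z. cinner l z = cinner x (T z)" using e by (auto simp: orthonormal_basis_def)
    then show ?thesis by blast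
  qed
  then obtain S where "\<And>x z. cinner (S x) z = cinner x (T z)" by metis
  then show thesis by (rule that)
qed

section \<open>Fourier analysis on the circle\<close>

lemma sets_circle_measure [measurable_cong, simp]: "sets circle_measure = sets borel"
  by (simp add: circle_measure_def)

lemma space_circle_measure [simp]: "space circle_measure = UNIV"
  by (simp add: circle_measure_def)

lemma measurable_circle_measure [simp]: "measurable circle_measure N = measurable borel N"
  by (rule measurable_cong_sets) simp_all

lemma borel_measurable_cis [measurable]: "cis \<in> borel_measurable borel"
  by (intro borel_measurable_continuous_onI continuous_intros)

lemma borel_measurable_cnj [measurable (raw)]:
  "f \<in> borel_measurable M \<Longrightarrow> (\<lambda>x. cnj (f x)) \<in> borel_measurable M"
  by (rule borel_measurable_continuous_on[where f=cnj]) (auto intro: continuous_intros)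

lemma integral_cnj_eq: "(\<integral>x. cnj (f x) \<partial>M) = cnj (\<integral>x. f x \<partial>M)"
  by (rule integral_bounded_linear'[OF bounded_linear_cnj bounded_linear_cnj]) simp

lemma circle_borel [measurable]: "circle \<in> sets borel"
proof -
  have "circle = sphere 0 1" by (auto simp: circle_def dist_norm)
  then show ?thesis by (metis borel_closed closed_sphere)
qed

lemma prob_space_circle_measure: "prob_space circle_measure"
  unfolding circle_measure_def
  by (intro prob_space.prob_space_distr prob_space_uniform_measure) simp_all

interpretation circle_measure: prob_space circle_measure
  by (rule prob_space_circle_measure)

lemma AE_circle: "AE l in circle_measure. l \<in> circle"
  unfolding circle_measure_def by (subst AE_distr_iff) (auto simp: circle_def)

text \<open>Changing the half-open interval to the closed one alters only a null set and gives the
  form in which the fundamental theorem of calculus applies.\<close>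

lemma integral_circle_measure:
  fixes f :: "complex \<Rightarrow> complex"
  assumes [measurable]: "f \<in> borel_measurable borel"
  shows "(\<integral>l. f l \<partial>circle_measure) = (1 / (2 * pi)) *\<^sub>R (\<integral>t. indicator {0..2*pi} t *\<^sub>R f (cis t) \<partial>lborel)"
proof -
  have eq: "uniform_measure lborel {0..<2*pi} = density lborel (\<lambda>t. ennreal (indicator {0..<2*pi} t / (2*pi)))"
    unfolding uniform_measure_def
    by (intro arg_cong2[where f=density] refl) (auto simp: fun_eq_iff divide_ennreal[of 1, simplified] split: split_indicator)
  have "(\<integral>l. f l \<partial>circle_measure) = (\<integral>t. (indicator {0..<2*pi} t / (2*pi)) *\<^sub>R f (cis t) \<partial>lborel)"
    unfolding circle_measure_def eq by (subst integral_distr) (auto intro!: integral_density)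
  also have "\<dots> = (\<integral>t. (1 / (2 * pi)) *\<^sub>R (indicator {0..2*pi} t *\<^sub>R f (cis t)) \<partial>lborel)"
  proof (rule integral_cong_AE)
    have "AE t in lborel. t \<noteq> 2 * pi" by (rule AE_lborel_singleton)
    then show "AE t in lborel. (indicator {0..<2*pi} t / (2*pi)) *\<^sub>R f (cis t)
       = (1 / (2 * pi)) *\<^sub>R (indicator {0..2*pi} t *\<^sub>R f (cis t))"
      by eventually_elim (auto split: split_indicator)
  qed simp_all
  also have "\<dots> = (1 / (2 * pi)) *\<^sub>R (\<integral>t. indicator {0..2*pi} t *\<^sub>R f (cis t) \<partial>lborel)"
    by (rule integral_scaleR_right)
  finally show ?thesis .
qed

text \<open>The antiderivative exp(i n t) / (i n) takes the same value at 0 and at 2 pi. Its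
  derivative along the real line is obtained from the complex derivative.\<close>

lemma integral_circle_power_pos:
  assumes "n > 0"
  shows "(\<integral>l. l ^ n \<partial>circle_measure) = 0"
proof -
  let ?F = "\<lambda>t. cis (real n * t) / (\<i> * of_nat n)"
  have "(\<integral>t. indicator {0..2*pi} t *\<^sub>R (cis t ^ n) \<partial>lborel) = ?F (2*pi) - ?F 0"
  proof (rule integral_FTC_Icc)
    fix x :: real
    have "((\<lambda>z. exp (\<i> * (of_nat n * z)) / (\<i> * of_nat n)) has_field_derivative exp (\<i> * (of_nat n * of_real x))) (at (of_real x))"
      using assms by (auto intro!: derivative_eq_intros simp: field_simps)
    from has_vector_derivative_real_field[OF this]
    show "(?F has_vector_derivative cis x ^ n) (at x within {0..2*pi})"
      by (simp add: cis_conv_exp mult.left_commute[of _ "of_nat n"] exp_of_nat_mult)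
  qed (auto intro!: continuous_intros)
  also have "cis (real n * (2 * pi)) = 1"
    using cis_multiple_2pi[of "real n"] by (simp add: mult.commute mult.left_commute)
  finally show ?thesis by (subst integral_circle_measure) simp_all
qed

text \<open>On the circle \<open>cnj l\<close> is the inverse of \<open>l\<close>, so for
  \<open>j \<le> i\<close> the integrand collapses to a single nonnegative power; the other case
  follows by conjugation.\<close>

lemma integral_circle_orthonormal:
  "(\<integral>l. l ^ i * cnj l ^ j \<partial>circle_measure) = (if i = j then 1 else 0)"
proof -
  have red: "(\<integral>l. l ^ i * cnj l ^ j \<partial>circle_measure) = (\<integral>l. l ^ (i - j) \<partial>circle_measure)" if "j \<le> i" for i j
  proof (rule integral_cong_AE)
    show "AE l in circle_measure. l ^ i * cnj l ^ j = l ^ (i - j)"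
      using AE_circle
    proof eventually_elim
      case (elim l)
      then have "l * cnj l = 1" by (simp add: circle_def complex_norm_square[symmetric])
      then have "l ^ j * cnj l ^ j = 1" by (simp flip: power_mult_distrib)
      moreover have "l ^ i = l ^ (i - j) * l ^ j" using that by (simp flip: power_add)
      ultimately show ?case by (simp add: mult.assoc)
    qed
  qed simp_all
  show ?thesis
  proof (cases "j \<le> i")
    case True
    then show ?thesis using red[OF True] integral_circle_power_pos[of "i - j"]
      using circle_measure.prob_space by auto
  next
    case False
    have "(\<integral>l. l ^ i * cnj l ^ j \<partial>circle_measure) = cnj (\<integral>l. l ^ j * cnj l ^ i \<partial>circle_measure)"
      by (subst integral_cnj_eq[symmetric]) (simp add: mult.commute)
    then show ?thesis using False red[of i j] integral_circle_power_pos[of "j - i"] by auto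
  qed
qed

text \<open>The complement of the circle is null, so a bound on the circle is enough. This matters
  because the eigenvector field is controlled only there.\<close>

lemma integrable_circle:
  fixes f :: "complex \<Rightarrow> 'b::{banach, second_countable_topology}"
  assumes "f \<in> borel_measurable borel" "\<And>l. l \<in> circle \<Longrightarrow> norm (f l) \<le> B"
  shows "integrable circle_measure f"
  using AE_circle by (intro circle_measure.integrable_const_bound[where B=B]) (auto simp: assms elim: eventually_mono)

lemma integral_circle_mono:
  fixes f g :: "complex \<Rightarrow> real"
  assumes "integrable circle_measure f" "integrable circle_measure g" "\<And>l. l \<in> circle \<Longrightarrow> f l \<le> g l"
  shows "(\<integral>l. f l \<partial>circle_measure) \<le> (\<integral>l. g l \<partial>circle_measure)"
  using AE_circle by (intro integral_mono_AE assms) (auto simp: assms elim: eventually_mono)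

lemma integral_circle_cong:
  assumes "f \<in> borel_measurable borel" "g \<in> borel_measurable borel" "\<And>l. l \<in> circle \<Longrightarrow> f l = g l"
  shows "(\<integral>l. f l \<partial>circle_measure) = (\<integral>l. g l \<partial>circle_measure)"
  using AE_circle by (intro integral_cong_AE) (auto simp: assms elim: eventually_mono)

text \<open>Riemann--Lebesgue, via Bessel's inequality for the exponentials.\<close>

lemma circle_Riemann_Lebesgue:
  fixes g :: "complex \<Rightarrow> complex"
  assumes [measurable]: "g \<in> borel_measurable borel" and B: "\<And>l. l \<in> circle \<Longrightarrow> norm (g l) \<le> B"
  shows "(\<lambda>n. \<integral>l. cnj l ^ n * g l \<partial>circle_measure) \<longlonglongrightarrow> 0"
proof -
  define c where "c n = (\<integral>l. cnj l ^ n * g l \<partial>circle_measure)" for n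
  have int1: "integrable circle_measure (\<lambda>l. cnj l ^ n * g l)" for n
    by (rule integrable_circle[where B=B]) (auto simp: norm_mult norm_power circle_def B)
  have int1': "integrable circle_measure (\<lambda>l. l ^ n * cnj (g l))" for n
    by (rule integrable_circle[where B=B]) (auto simp: norm_mult norm_power circle_def B)
  have int2: "integrable circle_measure (\<lambda>l. l ^ i * cnj l ^ j)" for i j :: nat
    by (rule integrable_circle[where B=1]) (auto simp: norm_mult norm_power circle_def)
  have int3: "integrable circle_measure (\<lambda>l. g l * cnj (g l))"
    by (rule integrable_circle[where B="B*B"]) (auto simp: norm_mult intro!: mult_mono B order_trans[OF norm_ge_zero B])
  have cc: "(\<integral>l. l ^ n * cnj (g l) \<partial>circle_measure) = cnj (c n)" for n
    unfolding c_def by (subst integral_cnj_eq[symmetric]) simp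
  \<comment> \<open>With the \<open>c n\<close> as coefficients, the integral of |g - sum c_n l^n|^2
    equals the integral of |g|^2 minus the sum of the |c_n|^2, and it is nonnegative.\<close>
  have bess: "(\<Sum>n<N. (cmod (c n))\<^sup>2) \<le> Re (\<integral>l. g l * cnj (g l) \<partial>circle_measure)" for N
  proof -
    have "(\<integral>l. (g l - (\<Sum>n<N. c n * l ^ n)) * cnj (g l - (\<Sum>n<N. c n * l ^ n)) \<partial>circle_measure)
      = (\<integral>l. g l * cnj (g l) - (\<Sum>n<N. c n * (l ^ n * cnj (g l))) - (\<Sum>n<N. cnj (c n) * (cnj l ^ n * g l))
         + (\<Sum>i<N. \<Sum>j<N. c i * (cnj (c j) * (l ^ i * cnj l ^ j))) \<partial>circle_measure)"
    proof (intro Bochner_Integration.integral_cong refl)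
      fix l
      define S where "S = (\<Sum>n<N. c n * l ^ n)"
      have "S * cnj S = (\<Sum>i<N. \<Sum>j<N. c i * (cnj (c j) * (l ^ i * cnj l ^ j)))"
        by (simp add: S_def sum_product ac_simps)
      moreover have "S * cnj (g l) = (\<Sum>n<N. c n * (l ^ n * cnj (g l)))"
        by (simp add: S_def sum_distrib_right mult.assoc)
      moreover have "cnj S * g l = (\<Sum>n<N. cnj (c n) * (cnj l ^ n * g l))"
        by (simp add: S_def sum_distrib_right mult.assoc)
      moreover have "(g l - S) * cnj (g l - S) = g l * cnj (g l) - S * cnj (g l) - cnj S * g l + S * cnj S"
        by (simp add: algebra_simps)
      ultimately show "(g l - (\<Sum>n<N. c n * l ^ n)) * cnj (g l - (\<Sum>n<N. c n * l ^ n)) =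
          g l * cnj (g l) - (\<Sum>n<N. c n * (l ^ n * cnj (g l))) - (\<Sum>n<N. cnj (c n) * (cnj l ^ n * g l))
         + (\<Sum>i<N. \<Sum>j<N. c i * (cnj (c j) * (l ^ i * cnj l ^ j)))"
        by (simp only: S_def)
    qed
    also have "\<dots> = (\<integral>l. g l * cnj (g l) \<partial>circle_measure) - (\<Sum>n<N. c n * cnj (c n)) - (\<Sum>n<N. cnj (c n) * c n)
         + (\<Sum>i<N. \<Sum>j<N. c i * (cnj (c j) * (if i = j then 1 else 0)))"
      by (simp add: int1 int1' int2 int3 cc integral_circle_orthonormal flip: c_def)
    also have "\<dots> = (\<integral>l. g l * cnj (g l) \<partial>circle_measure) - of_real (\<Sum>n<N. (cmod (c n))\<^sup>2)"
      by (simp add: complex_norm_square mult.commute if_distrib del: of_real_power cong: if_cong)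
    finally have eq: "(\<integral>l. (g l - (\<Sum>n<N. c n * l ^ n)) * cnj (g l - (\<Sum>n<N. c n * l ^ n)) \<partial>circle_measure)
      = (\<integral>l. g l * cnj (g l) \<partial>circle_measure) - of_real (\<Sum>n<N. (cmod (c n))\<^sup>2)" .
    have "(\<integral>l. (g l - (\<Sum>n<N. c n * l ^ n)) * cnj (g l - (\<Sum>n<N. c n * l ^ n)) \<partial>circle_measure)
       = of_real (\<integral>l. (cmod (g l - (\<Sum>n<N. c n * l ^ n)))\<^sup>2 \<partial>circle_measure)"
      by (subst integral_complex_of_real[symmetric]) (simp add: complex_norm_square del: of_real_power)
    then have "0 \<le> Re (\<integral>l. (g l - (\<Sum>n<N. c n * l ^ n)) * cnj (g l - (\<Sum>n<N. c n * l ^ n)) \<partial>circle_measure)"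
      by simp
    then show ?thesis unfolding eq by simp
  qed
  have "summable (\<lambda>n. (cmod (c n))\<^sup>2)"
  proof (rule bounded_imp_summable)
    show "(\<Sum>k\<le>n. (cmod (c k))\<^sup>2) \<le> Re (\<integral>l. g l * cnj (g l) \<partial>circle_measure)" for n
      using bess[of "Suc n"] by (simp add: lessThan_Suc_atMost)
  qed auto
  then have "(\<lambda>n. (cmod (c n))\<^sup>2) \<longlonglongrightarrow> 0" by (rule summable_LIMSEQ_zero)
  then have "(\<lambda>n. sqrt ((cmod (c n))\<^sup>2)) \<longlonglongrightarrow> sqrt 0" by (rule tendsto_real_sqrt)
  then have "(\<lambda>n. cmod (c n)) \<longlonglongrightarrow> 0" by simp
  then show ?thesis unfolding c_def by (rule tendsto_norm_zero_cancel)
qed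

text \<open>The square of its modulus is the Fejer kernel centred at \<open>v\<close>.\<close>

definition fejer_root :: "nat \<Rightarrow> complex \<Rightarrow> complex \<Rightarrow> complex" where
  "fejer_root N v l = (\<Sum>j<N. (l * cnj v) ^ j) / of_real (sqrt N)"

lemma fejer_root_measurable [measurable]: "fejer_root N v \<in> borel_measurable borel"
  unfolding fejer_root_def by measurable

lemma fejer_root_bound:
  assumes "l \<in> circle" "v \<in> circle"
  shows "cmod (fejer_root N v l) \<le> N"
proof -
  have "cmod (\<Sum>j<N. (l * cnj v) ^ j) \<le> (\<Sum>j<N. 1)"
    using assms by (intro sum_norm_le) (auto simp: circle_def norm_mult norm_power)
  moreover have "N \<noteq> 0 \<Longrightarrow> 1 \<le> sqrt N" by simp
  ultimately show ?thesis
    by (cases "N = 0") (auto simp: fejer_root_def norm_divide divide_le_eq intro: order_trans mult_left_mono[where a=1, simplified])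
qed

text \<open>Exchanging the variable and the centre conjugates the kernel. This makes averaging over
  the centre the same as integrating over the variable.\<close>

lemma fejer_root_commute: "cmod (fejer_root N v l) = cmod (fejer_root N l v)"
proof -
  have "fejer_root N v l = cnj (fejer_root N l v)" by (simp add: fejer_root_def mult.commute)
  then show ?thesis by simp
qed

text \<open>By orthonormality only the \<open>N\<close> diagonal terms survive, each equal to
  1/N.\<close>

lemma integral_fejer_root_square:
  assumes v: "v \<in> circle" and N: "N > 0"
  shows "(\<integral>l. (cmod (fejer_root N v l))\<^sup>2 \<partial>circle_measure) = 1"
proof -
  have vv: "v * cnj v = 1" using v by (simp add: circle_def complex_norm_square[symmetric])
  have int2: "integrable circle_measure (\<lambda>l. l ^ i * cnj l ^ j)" for i j :: nat
    by (rule integrable_circle[where B=1]) (auto simp: norm_mult norm_power circle_def)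
  have "complex_of_real (\<integral>l. (cmod (fejer_root N v l))\<^sup>2 \<partial>circle_measure) = (\<integral>l. fejer_root N v l * cnj (fejer_root N v l) \<partial>circle_measure)"
    by (subst integral_complex_of_real[symmetric]) (simp add: complex_norm_square del: of_real_power)
  also have "\<dots> = (\<integral>l. (\<Sum>i<N. \<Sum>j<N. (cnj v ^ i * v ^ j / of_nat N) * (l ^ i * cnj l ^ j)) \<partial>circle_measure)"
    by (intro Bochner_Integration.integral_cong refl)
       (simp add: fejer_root_def sum_product power_mult_distrib sum_divide_distrib ac_simps flip: of_real_mult)
  also have "\<dots> = (\<Sum>i<N. \<Sum>j<N. (cnj v ^ i * v ^ j / of_nat N) * (if i = j then 1 else 0))"
    by (simp add: int2 integral_circle_orthonormal)
  also have "\<dots> = (\<Sum>i<N. cnj v ^ i * v ^ i / of_nat N)"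
    by (simp add: if_distrib cong: if_cong)
  also have "\<dots> = 1"
    using N by (simp add: vv mult.commute flip: power_mult_distrib)
  finally show ?thesis using of_real_eq_1_iff by blast
qed

text \<open>On the circle |l - v| = |1 - l cnj(v)|, and this factor turns the geometric sum into 1 -
  (l cnj(v))^N, whose modulus is at most 2.\<close>

lemma fejer_root_concentrated:
  assumes "l \<in> circle" "v \<in> circle"
  shows "cmod (fejer_root N v l) * cmod (l - v) \<le> 2 / sqrt N"
proof -
  have "cmod (l - v) = cmod (1 - l * cnj v)"
  proof -
    have "cmod (1 - l * cnj v) = cmod (cnj v * v - l * cnj v)"
      using assms by (simp add: circle_def complex_norm_square[symmetric] mult.commute)
    also have "\<dots> = cmod (cnj v * (v - l))" by (simp add: algebra_simps)
    also have "\<dots> = cmod (l - v)" using assms by (simp add: norm_mult circle_def norm_minus_commute)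
    finally show ?thesis by simp
  qed
  then have "cmod (fejer_root N v l) * cmod (l - v) = cmod ((1 - l * cnj v) * (\<Sum>j<N. (l * cnj v) ^ j)) / sqrt N"
    by (simp add: fejer_root_def norm_divide norm_mult)
  also have "\<dots> = cmod (1 - (l * cnj v) ^ N) / sqrt N"
    by (simp only: one_diff_power_eq)
  also have "cmod (1 - (l * cnj v) ^ N) \<le> 1 + 1"
    using assms by (intro order_trans[OF norm_triangle_ineq4]) (simp add: norm_power norm_mult circle_def)
  finally show ?thesis by (simp add: divide_right_mono)
qed

text \<open>The squared kernel equals \<open>N\<close> at its centre but has integral 1, so the mass
  of the centre is at most 1/N for every \<open>N\<close>.\<close>

lemma measure_circle_singleton: "measure circle_measure {v} = 0"
proof (cases "v \<in> circle")
  case True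
  have le: "measure circle_measure {v} \<le> 1 / N" if N: "N > 0" for N :: nat
  proof -
    have vv: "v * cnj v = 1" using True by (simp add: circle_def complex_norm_square[symmetric])
    have kv: "cmod (fejer_root N v v) = sqrt N"
      using N by (simp add: fejer_root_def vv norm_divide real_div_sqrt)
    have "N * measure circle_measure {v} = (\<integral>l. real N * indicator {v} l \<partial>circle_measure)"
      by (subst integral_mult_right_zero) simp
    also have "\<dots> \<le> (\<integral>l. (cmod (fejer_root N v l))\<^sup>2 \<partial>circle_measure)"
    proof (rule integral_circle_mono)
      show "integrable circle_measure (\<lambda>l. (cmod (fejer_root N v l))\<^sup>2)"
        by (rule integrable_circle[where B="N\<^sup>2"]) (auto intro!: power_mono fejer_root_bound True)
      show "integrable circle_measure (\<lambda>l. real N * indicator {v} l)"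
        by (rule integrable_circle[where B="N"]) (auto split: split_indicator)
    qed (auto simp: kv split: split_indicator)
    also have "\<dots> = 1" by (rule integral_fejer_root_square[OF True N])
    finally show ?thesis using N by (simp add: field_simps)
  qed
  have "(\<lambda>n. 1 / real (Suc n)) \<longlonglongrightarrow> 0" by real_asymp
  then have "measure circle_measure {v} \<le> 0"
    by (rule LIMSEQ_le_const) (use le in blast)
  then show ?thesis by (simp add: measure_le_0_iff)
next
  case False
  have "AE l in circle_measure. l \<notin> {v}" using AE_circle by eventually_elim (use False in auto)
  then show ?thesis by (subst (asm) circle_measure.prob_eq_0[symmetric]) simp_all
qed

text \<open>Pointwise AM-GM: \<open>2\<bar>K\<bar> \<le> \<epsilon> \<bar>K\<bar>\<^sup>2 (1 + N\<bar>l - v\<bar>\<^sup>2) + 1 / (\<epsilon> (1 + N\<bar>l - v\<bar>\<^sup>2))\<close>, where the first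
  summand has bounded integral because \<open>K\<close> is concentrated at \<open>v\<close>.\<close>

lemma integral_norm_fejer_root_tendsto_0:
  assumes v: "\<And>i. v i \<in> circle" and lim: "v \<longlonglongrightarrow> v0" and N: "filterlim N at_top sequentially"
  shows "(\<lambda>i. \<integral>l. cmod (fejer_root (N i) (v i) l) \<partial>circle_measure) \<longlonglongrightarrow> 0"
proof -
  define h where "h i l = 1 / (1 + real (N i) * (cmod (l - v i))\<^sup>2)" for i l
  have hpos: "0 < 1 + real (N i) * (cmod (l - v i))\<^sup>2" for i l by (rule add_pos_nonneg) auto
  have h01: "0 < h i l" "h i l \<le> 1" for i l using hpos[of i l] by (simp_all add: h_def divide_le_eq)
  have [measurable]: "h i \<in> borel_measurable borel" for i unfolding h_def by measurable
  have inth: "integrable circle_measure (h i)" for i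
    by (rule integrable_circle[where B=1]) (use h01 in \<open>auto simp: less_imp_le\<close>)
  \<comment> \<open>Away from the limit centre \<open>v0\<close>, a null point, the denominators
    tend to infinity; the functions are dominated by 1.\<close>
  have "(\<lambda>i. \<integral>l. h i l \<partial>circle_measure) \<longlonglongrightarrow> (\<integral>l. 0 \<partial>circle_measure)"
  proof (rule integral_dominated_convergence[where w="\<lambda>_. 1"])
    have "AE l in circle_measure. l \<notin> {v0}"
      using measure_circle_singleton[of v0] by (subst (asm) circle_measure.prob_eq_0) simp_all
    then show "AE l in circle_measure. (\<lambda>i. h i l) \<longlonglongrightarrow> 0"
    proof eventually_elim
      case (elim l)
      have "(\<lambda>i. (cmod (l - v i))\<^sup>2) \<longlonglongrightarrow> (cmod (l - v0))\<^sup>2"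
        by (intro tendsto_intros lim)
      moreover have "(cmod (l - v0))\<^sup>2 > 0" using elim by simp
      moreover have "filterlim (\<lambda>i. real (N i)) at_top sequentially"
        by (rule filterlim_compose[OF filterlim_real_sequentially N])
      ultimately have "filterlim (\<lambda>i. (cmod (l - v i))\<^sup>2 * real (N i)) at_top sequentially"
        by (rule filterlim_tendsto_pos_mult_at_top)
      then have "filterlim (\<lambda>i. 1 + real (N i) * (cmod (l - v i))\<^sup>2) at_top sequentially"
        by (intro filterlim_tendsto_add_at_top[OF tendsto_const]) (simp add: mult.commute)
      then have "(\<lambda>i. inverse (1 + real (N i) * (cmod (l - v i))\<^sup>2)) \<longlonglongrightarrow> 0"
        by (rule tendsto_inverse_0_at_top)
      then show ?case by (simp add: h_def inverse_eq_divide)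
    qed
  qed (use h01 in \<open>auto simp: less_imp_le\<close>)
  then have hlim: "(\<lambda>i. \<integral>l. h i l \<partial>circle_measure) \<longlonglongrightarrow> 0" by simp
  \<comment> \<open>The coefficient 5 is 1 + 4: the squared kernel integrates to 1, and N (|K| |l -
    v|)^2 is at most 4 by concentration.\<close>
  have bound: "(\<integral>l. cmod (fejer_root (N i) (v i) l) \<partial>circle_measure) \<le> 5 * \<epsilon> + (\<integral>l. h i l \<partial>circle_measure) / \<epsilon>"
    if \<epsilon>: "\<epsilon> > 0" and Ni: "N i > 0" for i \<epsilon>
  proof -
    have intk: "integrable circle_measure (\<lambda>l. (cmod (fejer_root (N i) (v i) l))\<^sup>2)"
      by (rule integrable_circle[where B="(N i)\<^sup>2"]) (auto intro!: power_mono fejer_root_bound v)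
    have "(\<integral>l. cmod (fejer_root (N i) (v i) l) \<partial>circle_measure)
       \<le> (\<integral>l. \<epsilon> * ((cmod (fejer_root (N i) (v i) l))\<^sup>2 + 4) + h i l / \<epsilon> \<partial>circle_measure)"
    proof (rule integral_circle_mono)
      show "integrable circle_measure (\<lambda>l. cmod (fejer_root (N i) (v i) l))"
        by (rule integrable_circle[where B="N i"]) (auto intro!: fejer_root_bound v)
      show "integrable circle_measure (\<lambda>l. \<epsilon> * ((cmod (fejer_root (N i) (v i) l))\<^sup>2 + 4) + h i l / \<epsilon>)"
        using intk inth by simp
      fix l assume l: "l \<in> circle"
      define k where "k = cmod (fejer_root (N i) (v i) l)"
      define q where "q = 1 + real (N i) * (cmod (l - v i))\<^sup>2"
      have q: "q > 0" using hpos[of i l] by (simp add: q_def)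
      have "(k * cmod (l - v i))\<^sup>2 \<le> (2 / sqrt (N i))\<^sup>2"
        unfolding k_def by (intro power_mono fejer_root_concentrated l v) auto
      then have "real (N i) * (k * cmod (l - v i))\<^sup>2 \<le> 4"
        using Ni by (simp add: power_divide field_simps)
      then have kq: "k\<^sup>2 * q \<le> k\<^sup>2 + 4" by (simp add: q_def algebra_simps power_mult_distrib)
      have "0 \<le> (sqrt (\<epsilon> * q) * k - 1 / sqrt (\<epsilon> * q))\<^sup>2" by simp
      also have "\<dots> = \<epsilon> * (k\<^sup>2 * q) + 1 / (\<epsilon> * q) - 2 * k"
        using \<epsilon> q by (simp add: power2_diff power_mult_distrib power_divide)
      finally have "2 * k \<le> \<epsilon> * (k\<^sup>2 + 4) + 1 / (\<epsilon> * q)"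
        using mult_left_mono[OF kq, of \<epsilon>] \<epsilon> by linarith
      moreover have "0 \<le> k" by (simp add: k_def)
      ultimately have "k \<le> \<epsilon> * (k\<^sup>2 + 4) + 1 / (\<epsilon> * q)" by linarith
      also have "1 / (\<epsilon> * q) = h i l / \<epsilon>" by (simp add: h_def q_def)
      finally show "cmod (fejer_root (N i) (v i) l) \<le> \<epsilon> * ((cmod (fejer_root (N i) (v i) l))\<^sup>2 + 4) + h i l / \<epsilon>"
        by (simp add: k_def)
    qed
    also have "\<dots> = 5 * \<epsilon> + (\<integral>l. h i l \<partial>circle_measure) / \<epsilon>"
      using intk inth integral_fejer_root_square[OF v Ni, of i]
      by (simp add: circle_measure.prob_space[simplified])
    finally show ?thesis .
  qed
  show ?thesis
  proof (rule LIMSEQ_I)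
    fix r :: real assume r: "r > 0"
    \<comment> \<open>With this choice each of the two summands of the bound is at most r/2.\<close>
    define \<epsilon> where "\<epsilon> = r / 10"
    have \<epsilon>: "\<epsilon> > 0" using r by (simp add: \<epsilon>_def)
    have "eventually (\<lambda>i. (\<integral>l. h i l \<partial>circle_measure) < 5 * \<epsilon> * \<epsilon>) sequentially"
      using \<epsilon> by (intro order_tendstoD[OF hlim]) simp
    moreover have "eventually (\<lambda>i. N i > 0) sequentially"
      using N by (simp add: filterlim_iff eventually_gt_at_top)
    ultimately have "eventually (\<lambda>i. (\<integral>l. cmod (fejer_root (N i) (v i) l) \<partial>circle_measure) < r) sequentially"
    proof eventually_elim
      case (elim i)
      have "(\<integral>l. h i l \<partial>circle_measure) / \<epsilon> < 5 * \<epsilon>" using elim(1) \<epsilon> by (simp add: divide_less_eq)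
      with bound[OF \<epsilon> elim(2)] show ?case by (simp add: \<epsilon>_def)
    qed
    then show "\<exists>n0. \<forall>n\<ge>n0. norm ((\<integral>l. cmod (fejer_root (N n) (v n) l) \<partial>circle_measure) - 0) < r"
      by (simp add: eventually_sequentially)
  qed
qed

section \<open>Concentrating kernels\<close>

text \<open>By Fubini and the symmetry of the kernel, the right-hand side averaged over all centres
  \<open>v\<close> equals the integral of \<open>w\<close>. Hence it cannot be strictly smaller for
  every \<open>v\<close>.\<close>

lemma exists_fejer_root_integral_ge:
  fixes w :: "complex \<Rightarrow> real"
  assumes [measurable]: "w \<in> borel_measurable borel" and w: "\<And>l. l \<in> circle \<Longrightarrow> \<bar>w l\<bar> \<le> B" and N: "N > 0"
  shows "\<exists>v\<in>circle. (\<integral>l. w l \<partial>circle_measure) \<le> (\<integral>l. (cmod (fejer_root N v l))\<^sup>2 * w l \<partial>circle_measure)"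
proof (rule ccontr)
  assume "\<not> ?thesis"
  then have less: "(\<integral>l. (cmod (fejer_root N v l))\<^sup>2 * w l \<partial>circle_measure) < (\<integral>l. w l \<partial>circle_measure)"
    if "v \<in> circle" for v
    using that by (auto simp: not_le)
  interpret pair_prob_space circle_measure circle_measure ..
  have [measurable]: "(\<lambda>x. fejer_root N (snd x) (fst x)) \<in> borel_measurable (circle_measure \<Otimes>\<^sub>M circle_measure)"
    unfolding fejer_root_def by measurable
  have "AE x in circle_measure \<Otimes>\<^sub>M circle_measure. fst x \<in> circle \<and> snd x \<in> circle"
  proof (rule AE_pair_measure)
    show "{x \<in> space (circle_measure \<Otimes>\<^sub>M circle_measure). fst x \<in> circle \<and> snd x \<in> circle}
        \<in> sets (circle_measure \<Otimes>\<^sub>M circle_measure)"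
      by measurable
  qed (use AE_circle in \<open>auto elim!: eventually_mono\<close>)
  \<comment> \<open>Boundedness almost everywhere on the product gives the joint integrability that
    Fubini requires.\<close>
  then have "AE x in circle_measure \<Otimes>\<^sub>M circle_measure. norm ((cmod (fejer_root N (snd x) (fst x)))\<^sup>2 * w (fst x)) \<le> N\<^sup>2 * B"
  proof eventually_elim
    case (elim x)
    then have "(cmod (fejer_root N (snd x) (fst x)))\<^sup>2 * \<bar>w (fst x)\<bar> \<le> N\<^sup>2 * B"
      unfolding of_nat_power using fejer_root_bound[of "fst x" "snd x" N] w[of "fst x"] by (intro mult_mono power_mono) auto
    then show ?case by (simp add: abs_mult)
  qed
  then have int: "integrable (circle_measure \<Otimes>\<^sub>M circle_measure) (\<lambda>(l, v). (cmod (fejer_root N v l))\<^sup>2 * w l)"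
    unfolding case_prod_beta by (intro integrable_const_bound[where B="N\<^sup>2 * B"]) simp_all
  have "(\<integral>v. (\<integral>l. (cmod (fejer_root N v l))\<^sup>2 * w l \<partial>circle_measure) \<partial>circle_measure)
     = (\<integral>l. (\<integral>v. (cmod (fejer_root N v l))\<^sup>2 * w l \<partial>circle_measure) \<partial>circle_measure)"
    using Fubini_integral[OF int] .
  also have "\<dots> = (\<integral>l. w l \<partial>circle_measure)"
  proof (rule integral_circle_cong)
    show "(\<lambda>l. \<integral>v. (cmod (fejer_root N v l))\<^sup>2 * w l \<partial>circle_measure) \<in> borel_measurable borel"
      using borel_measurable_integrable[OF integrable_fst'[OF int]] by simp
    show "(\<integral>v. (cmod (fejer_root N v l))\<^sup>2 * w l \<partial>circle_measure) = w l" if "l \<in> circle" for l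
      using integral_fejer_root_square[OF that N] fejer_root_commute[of N _ l] by simp
  qed simp
  finally have eq: "(\<integral>v. (\<integral>l. (cmod (fejer_root N v l))\<^sup>2 * w l \<partial>circle_measure) \<partial>circle_measure) = (\<integral>l. w l \<partial>circle_measure)" .
  have "(\<integral>v. (\<integral>l. (cmod (fejer_root N v l))\<^sup>2 * w l \<partial>circle_measure) \<partial>circle_measure) < (\<integral>l. w l \<partial>circle_measure)"
    using integrable_snd[OF int] AE_circle less
    by (intro circle_measure.expectation_less) (auto elim!: eventually_mono)
  with eq show False by simp
qed

text \<open>Centres \<open>y i\<close> are chosen so that the weighted mass \<open>G i\<close> stays
  at least the integral of \<open>w\<close>. A subsequence along which centres and masses converge
  yields the location \<open>v0\<close> and the mass \<alpha>, which is positive because of that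
  lower bound.\<close>

lemma concentrating_fejer_roots:
  fixes w :: "complex \<Rightarrow> real"
  assumes w_meas [measurable]: "w \<in> borel_measurable borel"
    and w: "\<And>l. l \<in> circle \<Longrightarrow> 0 \<le> w l" "\<And>l. l \<in> circle \<Longrightarrow> w l \<le> B"
    and pos: "(\<integral>l. w l \<partial>circle_measure) > 0"
  obtains N v v0 \<alpha> where "\<And>i. N i > 0" "\<And>i. v i \<in> circle" "v0 \<in> circle" "\<alpha> > 0"
    "(\<lambda>i. \<integral>l. cmod (fejer_root (N i) (v i) l) \<partial>circle_measure) \<longlonglongrightarrow> 0"
    "\<And>n. (\<lambda>i. \<integral>l. cnj l ^ n * of_real ((cmod (fejer_root (N i) (v i) l))\<^sup>2 * w l) \<partial>circle_measure)
       \<longlonglongrightarrow> of_real \<alpha> * cnj v0 ^ n"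
proof -
  have B0: "0 \<le> B" using w[of 1] by (simp add: circle_def)
  have wabs: "\<bar>w l\<bar> \<le> B" if "l \<in> circle" for l using w[OF that] by simp
  have "\<forall>i. \<exists>v. v \<in> circle \<and> (\<integral>l. w l \<partial>circle_measure) \<le> (\<integral>l. (cmod (fejer_root (Suc i) v l))\<^sup>2 * w l \<partial>circle_measure)"
    using exists_fejer_root_integral_ge[OF w_meas wabs zero_less_Suc] by blast
  then obtain y where y: "\<And>i. y i \<in> circle"
    and yge: "\<And>i. (\<integral>l. w l \<partial>circle_measure) \<le> (\<integral>l. (cmod (fejer_root (Suc i) (y i) l))\<^sup>2 * w l \<partial>circle_measure)"
    by metis
  have kint: "integrable circle_measure (\<lambda>l. (cmod (fejer_root N v l))\<^sup>2)" if "v \<in> circle" for N v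
    by (rule integrable_circle[where B="N\<^sup>2"]) (auto intro!: power_mono fejer_root_bound that)
  have kint1: "integrable circle_measure (\<lambda>l. cmod (fejer_root N v l))" if "v \<in> circle" for N v
    by (rule integrable_circle[where B="N"]) (auto intro!: fejer_root_bound that)
  have kwint: "integrable circle_measure (\<lambda>l. (cmod (fejer_root N v l))\<^sup>2 * w l)" if "v \<in> circle" for N v
    by (rule integrable_circle[where B="N\<^sup>2 * B"])
       (auto simp: abs_mult intro!: mult_mono power_mono fejer_root_bound that wabs)
  define G where "G i = (\<integral>l. (cmod (fejer_root (Suc i) (y i) l))\<^sup>2 * w l \<partial>circle_measure)" for i
  have Gle: "G i \<le> B" for i
  proof -
    have "G i \<le> (\<integral>l. (cmod (fejer_root (Suc i) (y i) l))\<^sup>2 * B \<partial>circle_measure)"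
      unfolding G_def by (intro integral_circle_mono kwint y) (auto intro!: mult_left_mono w kint y)
    also have "\<dots> = B" using integral_fejer_root_square[OF y, of "Suc i" i] by simp
    finally show ?thesis .
  qed
  have "compact (circle \<times> {(\<integral>l. w l \<partial>circle_measure)..B})"
  proof -
    have "circle = sphere 0 1" by (auto simp: circle_def dist_norm)
    then show ?thesis by (metis compact_Times compact_sphere compact_Icc)
  qed
  moreover have "\<forall>i. (y i, G i) \<in> circle \<times> {(\<integral>l. w l \<partial>circle_measure)..B}"
    using y yge Gle by (simp add: G_def)
  ultimately obtain z r where z: "z \<in> circle \<times> {(\<integral>l. w l \<partial>circle_measure)..B}"
    and r: "strict_mono (r :: nat \<Rightarrow> nat)" and lim: "((\<lambda>i. (y i, G i)) \<circ> r) \<longlonglongrightarrow> z"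
    unfolding compact_def by (metis (no_types, lifting))
  define v0 \<alpha> where "v0 = fst z" and "\<alpha> = snd z"
  have v0: "v0 \<in> circle" and \<alpha>: "\<alpha> > 0" using z pos by (auto simp: v0_def \<alpha>_def)
  have vlim: "(\<lambda>i. y (r i)) \<longlonglongrightarrow> v0" and Glim: "(\<lambda>i. G (r i)) \<longlonglongrightarrow> \<alpha>"
    using tendsto_fst[OF lim] tendsto_snd[OF lim] by (simp_all add: v0_def \<alpha>_def o_def)
  have "filterlim (\<lambda>i. Suc (r i)) sequentially sequentially"
    using r by (intro filterlim_subseq) (auto simp: strict_mono_def)
  then have lim1: "(\<lambda>i. \<integral>l. cmod (fejer_root (Suc (r i)) (y (r i)) l) \<partial>circle_measure) \<longlonglongrightarrow> 0"
    by (intro integral_norm_fejer_root_tendsto_0[OF _ vlim] y)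
  show thesis
  proof (rule that)
    show "(\<lambda>i. \<integral>l. cnj l ^ n * of_real ((cmod (fejer_root (Suc (r i)) (y (r i)) l))\<^sup>2 * w l) \<partial>circle_measure)
       \<longlonglongrightarrow> of_real \<alpha> * cnj v0 ^ n" for n
    proof -
      \<comment> \<open>Replacing \<open>cnj l ^ n\<close> by its value at the centre costs at most
        n |l - y|. One of the two kernel factors absorbs |l - y| by concentration, and the other
        leaves the vanishing L1 norm.\<close>
      have diff: "cmod ((\<integral>l. cnj l ^ n * of_real ((cmod (fejer_root (Suc i) (y i) l))\<^sup>2 * w l) \<partial>circle_measure)
          - of_real (G i) * cnj (y i) ^ n) \<le> 2 * n * B * (\<integral>l. cmod (fejer_root (Suc i) (y i) l) \<partial>circle_measure)" for i
      proof -
        define k where "k l = cmod (fejer_root (Suc i) (y i) l)" for l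
        have [measurable]: "k \<in> borel_measurable borel" unfolding k_def by measurable
        have kw: "integrable circle_measure (\<lambda>l. (k l)\<^sup>2 * w l)" unfolding k_def by (rule kwint[OF y])
        have i1: "integrable circle_measure (\<lambda>l. cnj l ^ n * of_real ((k l)\<^sup>2 * w l))"
          by (rule integrable_circle[where B="(Suc i)\<^sup>2 * B"])
             (auto simp: k_def norm_mult norm_power circle_def simp del: of_nat_Suc
              intro!: mult_mono power_mono fejer_root_bound y wabs)
        have i2: "integrable circle_measure (\<lambda>l. cnj (y i) ^ n * complex_of_real ((k l)\<^sup>2 * w l))"
          using kw by (intro integrable_mult_right integrable_of_real)
        have "of_real (G i) * cnj (y i) ^ n = (\<integral>l. cnj (y i) ^ n * complex_of_real ((k l)\<^sup>2 * w l) \<partial>circle_measure)"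
          by (simp only: G_def k_def integral_mult_right_zero integral_complex_of_real mult.commute)
        then have "cmod ((\<integral>l. cnj l ^ n * of_real ((k l)\<^sup>2 * w l) \<partial>circle_measure) - of_real (G i) * cnj (y i) ^ n)
          = cmod (\<integral>l. cnj l ^ n * of_real ((k l)\<^sup>2 * w l) - cnj (y i) ^ n * of_real ((k l)\<^sup>2 * w l) \<partial>circle_measure)"
          by (simp only: Bochner_Integration.integral_diff[OF i1 i2])
        also have "\<dots> \<le> (\<integral>l. cmod (cnj l ^ n * of_real ((k l)\<^sup>2 * w l) - cnj (y i) ^ n * of_real ((k l)\<^sup>2 * w l)) \<partial>circle_measure)"
          by (rule integral_norm_bound)
        also have "\<dots> \<le> (\<integral>l. 2 * n * B * k l \<partial>circle_measure)"
        proof (rule integral_circle_mono)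
          show "integrable circle_measure (\<lambda>l. cmod (cnj l ^ n * of_real ((k l)\<^sup>2 * w l) - cnj (y i) ^ n * of_real ((k l)\<^sup>2 * w l)))"
            using i1 i2 by (intro integrable_norm Bochner_Integration.integrable_diff)
          show "integrable circle_measure (\<lambda>l. 2 * n * B * k l)"
            unfolding k_def by (intro integrable_mult_right kint1 y)
          fix l assume l: "l \<in> circle"
          have "k l * cmod (l - y i) \<le> 2 / sqrt (Suc i)"
            unfolding k_def by (rule fejer_root_concentrated[OF l y])
          also have "\<dots> \<le> 2" by (simp add: divide_le_eq)
          finally have kc: "k l * cmod (l - y i) \<le> 2" .
          have pd: "cmod (cnj l ^ n - cnj (y i) ^ n) \<le> n * cmod (l - y i)"
            using norm_power_diff[of "cnj l" "cnj (y i)" n] l y[of i]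
            by (simp add: circle_def flip: complex_cnj_diff)
          have kpos: "0 \<le> k l" by (simp add: k_def)
          have "cmod (cnj l ^ n * of_real ((k l)\<^sup>2 * w l) - cnj (y i) ^ n * of_real ((k l)\<^sup>2 * w l))
             = cmod (cnj l ^ n - cnj (y i) ^ n) * ((k l)\<^sup>2 * w l)"
            using w(1)[OF l] by (simp only: left_diff_distrib[symmetric] norm_mult norm_of_real abs_mult) simp
          also have "\<dots> \<le> (n * cmod (l - y i)) * ((k l)\<^sup>2 * B)"
            using pd w[OF l] by (intro mult_mono) (auto intro: mult_left_mono)
          also have "\<dots> = (n * B * k l) * (k l * cmod (l - y i))"
            by (simp add: power2_eq_square algebra_simps)
          also have "\<dots> \<le> (n * B * k l) * 2"
            using kc B0 kpos by (intro mult_left_mono) auto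
          finally show "cmod (cnj l ^ n * of_real ((k l)\<^sup>2 * w l) - cnj (y i) ^ n * of_real ((k l)\<^sup>2 * w l)) \<le> 2 * n * B * k l"
            by (simp add: algebra_simps)
        qed
        finally show ?thesis by (simp add: k_def)
      qed
      have "(\<lambda>i. (\<integral>l. cnj l ^ n * of_real ((cmod (fejer_root (Suc (r i)) (y (r i)) l))\<^sup>2 * w l) \<partial>circle_measure)
          - of_real (G (r i)) * cnj (y (r i)) ^ n) \<longlonglongrightarrow> 0"
      proof (rule Lim_null_comparison)
        show "\<forall>\<^sub>F i in sequentially. norm ((\<integral>l. cnj l ^ n * of_real ((cmod (fejer_root (Suc (r i)) (y (r i)) l))\<^sup>2 * w l) \<partial>circle_measure)
          - of_real (G (r i)) * cnj (y (r i)) ^ n) \<le> 2 * n * B * (\<integral>l. cmod (fejer_root (Suc (r i)) (y (r i)) l) \<partial>circle_measure)"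
          using diff by (intro always_eventually allI)
        show "(\<lambda>i. 2 * n * B * (\<integral>l. cmod (fejer_root (Suc (r i)) (y (r i)) l) \<partial>circle_measure)) \<longlonglongrightarrow> 0"
          using tendsto_mult_left[OF lim1, of "2 * n * B"] by simp
      qed
      moreover have "(\<lambda>i. of_real (G (r i)) * cnj (y (r i)) ^ n) \<longlonglongrightarrow> of_real \<alpha> * cnj v0 ^ n"
        by (intro tendsto_intros Glim vlim)
      ultimately show ?thesis by (rule Lim_transform[rotated])
    qed
  qed (use y v0 \<alpha> lim1 in simp_all)
qed

text \<open>With w = |phi|^2 for phi = <x, E>, and a vector y satisfying <y, E> = P phi, this is the
  n-th correlation of the functional <y, .> with itself.\<close>

definition autocorr :: "(complex \<Rightarrow> real) \<Rightarrow> nat \<Rightarrow> (complex \<Rightarrow> complex) \<Rightarrow> complex" where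
  "autocorr w n P = (\<integral>l. cnj l ^ n * of_real ((cmod (P l))\<^sup>2 * w l) \<partial>circle_measure)"

text \<open>The invariant carried along the recursive construction: it provides integrability of all
  the products and the Riemann-Lebesgue lemma at each stage.\<close>

definition bdd_on_circle :: "(complex \<Rightarrow> complex) \<Rightarrow> bool" where
  "bdd_on_circle P \<longleftrightarrow> P \<in> borel_measurable borel \<and> (\<exists>C. \<forall>l\<in>circle. cmod (P l) \<le> C)"

lemma bdd_on_circleE:
  assumes "bdd_on_circle P"
  obtains C where "P \<in> borel_measurable borel" "\<And>l. l \<in> circle \<Longrightarrow> cmod (P l) \<le> C" "C \<ge> 0"
proof -
  from assms obtain C where "P \<in> borel_measurable borel" "\<forall>l\<in>circle. cmod (P l) \<le> C"
    by (auto simp: bdd_on_circle_def)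
  then show thesis by (intro that[of "max C 0"]) auto
qed

lemma bdd_on_circle_add_mult:
  assumes "bdd_on_circle P" "bdd_on_circle Q"
  shows "bdd_on_circle (\<lambda>l. P l + a * Q l)"
proof -
  from assms(1) obtain C where P [measurable]: "P \<in> borel_measurable borel" and C: "\<And>l. l \<in> circle \<Longrightarrow> cmod (P l) \<le> C"
    by (metis bdd_on_circleE)
  from assms(2) obtain D where Q [measurable]: "Q \<in> borel_measurable borel" and D: "\<And>l. l \<in> circle \<Longrightarrow> cmod (Q l) \<le> D"
    by (metis bdd_on_circleE)
  have "cmod (P l + a * Q l) \<le> C + cmod a * D" if "l \<in> circle" for l
    using C[OF that] D[OF that]
    by (intro order_trans[OF norm_triangle_ineq]) (auto simp: norm_mult intro!: add_mono mult_left_mono)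
  then show ?thesis unfolding bdd_on_circle_def by auto
qed

section \<open>Slowly decaying Fourier coefficients\<close>

context
  fixes w :: "complex \<Rightarrow> real" and B :: real
  assumes w_meas [measurable]: "w \<in> borel_measurable borel"
    and w: "\<And>l. l \<in> circle \<Longrightarrow> 0 \<le> w l" "\<And>l. l \<in> circle \<Longrightarrow> w l \<le> B"
begin

lemma autocorr_tendsto_0:
  assumes "bdd_on_circle P"
  shows "(\<lambda>n. autocorr w n P) \<longlonglongrightarrow> 0"
proof -
  from assms obtain C where P [measurable]: "P \<in> borel_measurable borel" and C: "\<And>l. l \<in> circle \<Longrightarrow> cmod (P l) \<le> C"
    by (metis bdd_on_circleE)
  show ?thesis unfolding autocorr_def
    by (rule circle_Riemann_Lebesgue[where B="C\<^sup>2 * B"])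
       (auto simp: norm_mult norm_power abs_mult C w intro!: mult_mono power_mono)
qed

lemma integrable_autocorr:
  assumes "bdd_on_circle P"
  shows "integrable circle_measure (\<lambda>l. cnj l ^ n * of_real ((cmod (P l))\<^sup>2 * w l))"
    and "integrable circle_measure (\<lambda>l. (cmod (P l))\<^sup>2 * w l)"
    and "integrable circle_measure (\<lambda>l. cmod (P l))"
proof -
  from assms obtain C where P [measurable]: "P \<in> borel_measurable borel" and C: "\<And>l. l \<in> circle \<Longrightarrow> cmod (P l) \<le> C"
    by (metis bdd_on_circleE)
  show "integrable circle_measure (\<lambda>l. cnj l ^ n * of_real ((cmod (P l))\<^sup>2 * w l))"
    by (rule integrable_circle[where B="C\<^sup>2 * B"])
       (auto simp: norm_mult norm_power abs_mult C w circle_def intro!: mult_mono power_mono)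
  show "integrable circle_measure (\<lambda>l. (cmod (P l))\<^sup>2 * w l)"
    by (rule integrable_circle[where B="C\<^sup>2 * B"])
       (auto simp: norm_mult norm_power abs_mult C w intro!: mult_mono power_mono)
  show "integrable circle_measure (\<lambda>l. cmod (P l))"
    by (rule integrable_circle[where B=C]) (auto simp: C)
qed

lemma norm_autocorr_le:
  assumes "bdd_on_circle P"
  shows "cmod (autocorr w n P) \<le> (\<integral>l. (cmod (P l))\<^sup>2 * w l \<partial>circle_measure)"
  unfolding autocorr_def
  by (rule order_trans[OF integral_norm_bound],
      rule integral_circle_mono[OF integrable_norm[OF integrable_autocorr(1)[OF assms]] integrable_autocorr(2)[OF assms]])
     (use w in \<open>auto simp: norm_mult norm_power circle_def\<close>)

text \<open>For real \<open>a\<close> the defect is the integral of the cross term 2 a Re(P cnj(Q))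
  w against a unimodular factor, so the bound is uniform in \<open>n\<close>. It is small when
  \<open>Q\<close> is small in L1.\<close>

lemma autocorr_add_mult:
  assumes "bdd_on_circle P" "bdd_on_circle Q" and C: "\<And>l. l \<in> circle \<Longrightarrow> cmod (P l) \<le> C"
  shows "cmod (autocorr w n (\<lambda>l. P l + of_real a * Q l) - autocorr w n P - of_real (a\<^sup>2) * autocorr w n Q)
    \<le> 2 * \<bar>a\<bar> * C * B * (\<integral>l. cmod (Q l) \<partial>circle_measure)"
proof -
  note i = integrable_autocorr(1)[OF bdd_on_circle_add_mult[OF assms(1,2)]]
    integrable_autocorr(1)[OF assms(1)] integrable_autocorr(1)[OF assms(2)]
  have C0: "0 \<le> C" using C[of 1] order_trans[OF norm_ge_zero] by (auto simp: circle_def)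
  have B0: "0 \<le> B" using w[of 1] by (simp add: circle_def)
  have "cmod (autocorr w n (\<lambda>l. P l + of_real a * Q l) - autocorr w n P - of_real (a\<^sup>2) * autocorr w n Q)
     = cmod (\<integral>l. cnj l ^ n * of_real ((cmod (P l + of_real a * Q l))\<^sup>2 * w l) - cnj l ^ n * of_real ((cmod (P l))\<^sup>2 * w l)
         - of_real (a\<^sup>2) * (cnj l ^ n * of_real ((cmod (Q l))\<^sup>2 * w l)) \<partial>circle_measure)"
    unfolding autocorr_def using i
    by (subst Bochner_Integration.integral_diff Bochner_Integration.integral_diff integral_mult_right_zero
        | intro Bochner_Integration.integrable_diff integrable_mult_right | simp only:)+
  also have "\<dots> \<le> (\<integral>l. cmod (cnj l ^ n * of_real ((cmod (P l + of_real a * Q l))\<^sup>2 * w l) - cnj l ^ n * of_real ((cmod (P l))\<^sup>2 * w l)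
         - of_real (a\<^sup>2) * (cnj l ^ n * of_real ((cmod (Q l))\<^sup>2 * w l))) \<partial>circle_measure)"
    by (rule integral_norm_bound)
  also have "\<dots> \<le> (\<integral>l. 2 * \<bar>a\<bar> * C * B * cmod (Q l) \<partial>circle_measure)"
  proof (rule integral_circle_mono)
    fix l assume l: "l \<in> circle"
    have alg: "z * of_real (x * v) - z * of_real (y * v) - of_real (a\<^sup>2) * (z * of_real (q * v)) = z * of_real ((x - y - a\<^sup>2 * q) * v)"
      for z :: complex and x y q v :: real
      by (simp add: algebra_simps)
    have key: "(cmod (P l + of_real a * Q l))\<^sup>2 - (cmod (P l))\<^sup>2 - a\<^sup>2 * (cmod (Q l))\<^sup>2 = 2 * a * Re (P l * cnj (Q l))"
      unfolding cmod_power2 by (simp add: power2_eq_square algebra_simps)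
    have "cmod (cnj l ^ n * of_real ((cmod (P l + of_real a * Q l))\<^sup>2 * w l) - cnj l ^ n * of_real ((cmod (P l))\<^sup>2 * w l)
         - of_real (a\<^sup>2) * (cnj l ^ n * of_real ((cmod (Q l))\<^sup>2 * w l))) = cmod (cnj l ^ n * of_real (2 * a * Re (P l * cnj (Q l)) * w l))"
      unfolding alg key ..
    also have "\<dots> = 2 * \<bar>a\<bar> * \<bar>Re (P l * cnj (Q l))\<bar> * w l"
      using l w(1)[OF l] by (simp only: norm_mult norm_power norm_of_real abs_mult) (simp add: circle_def)
    also have "\<dots> \<le> 2 * \<bar>a\<bar> * (C * cmod (Q l)) * B"
    proof (intro mult_mono)
      have "\<bar>Re (P l * cnj (Q l))\<bar> \<le> cmod (P l) * cmod (Q l)"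
        using abs_Re_le_cmod[of "P l * cnj (Q l)"] by (simp add: norm_mult)
      also have "\<dots> \<le> C * cmod (Q l)" by (intro mult_right_mono C l) simp
      finally show "\<bar>Re (P l * cnj (Q l))\<bar> \<le> C * cmod (Q l)" .
    qed (use w[OF l] C0 in auto)
    finally show "cmod (cnj l ^ n * of_real ((cmod (P l + of_real a * Q l))\<^sup>2 * w l) - cnj l ^ n * of_real ((cmod (P l))\<^sup>2 * w l)
         - of_real (a\<^sup>2) * (cnj l ^ n * of_real ((cmod (Q l))\<^sup>2 * w l))) \<le> 2 * \<bar>a\<bar> * C * B * cmod (Q l)"
      by (simp add: algebra_simps)
  next
    show "integrable circle_measure (\<lambda>l. cmod (cnj l ^ n * of_real ((cmod (P l + of_real a * Q l))\<^sup>2 * w l) - cnj l ^ n * of_real ((cmod (P l))\<^sup>2 * w l)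
         - of_real (a\<^sup>2) * (cnj l ^ n * of_real ((cmod (Q l))\<^sup>2 * w l))))"
      by (intro integrable_norm Bochner_Integration.integrable_diff integrable_mult_right i)
    show "integrable circle_measure (\<lambda>l. 2 * \<bar>a\<bar> * C * B * cmod (Q l))"
      by (intro integrable_mult_right integrable_autocorr(3)[OF assms(2)])
  qed
  also have "\<dots> = 2 * \<bar>a\<bar> * C * B * (\<integral>l. cmod (Q l) \<partial>circle_measure)" by simp
  finally show ?thesis .
qed

text \<open>Block \<open>k\<close> consists of the \<open>n\<close> with \<open>M k \<le> n\<close>
  that precede all later starts. There the coefficient of \<open>P k\<close> and \<open>s n\<close>
  are at most a_k^2, term \<open>k\<close> is only crudely bounded, and every later term contributes
  nearly \<alpha> a_j^2 with a common phase.\<close>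

lemma slowly_decaying_autocorr:
  assumes u: "\<And>i. bdd_on_circle (u i)"
    and P1: "\<And>i. (\<integral>l. (cmod (u i l))\<^sup>2 * w l \<partial>circle_measure) \<le> B"
    and P2: "\<And>n. (\<lambda>i. autocorr w n (u i)) \<longlonglongrightarrow> of_real \<alpha> * cnj v0 ^ n"
    and P3: "(\<lambda>i. \<integral>l. cmod (u i l) \<partial>circle_measure) \<longlonglongrightarrow> 0"
    and \<alpha>: "\<alpha> > 0" and v0: "v0 \<in> circle"
    and s: "s \<longlonglongrightarrow> (0::real)"
  shows "\<exists>(i::nat \<Rightarrow> nat) a C. (\<forall>k. \<bar>a k\<bar> \<le> C / (real k + 1)\<^sup>2) \<and>
    (\<forall>n. \<forall>\<^sub>F K in sequentially. s n \<le> cmod (autocorr w n (\<lambda>l. \<Sum>k<K. of_real (a k) * u (i k) l)))"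
proof -
  \<comment> \<open>In the required lower bound, 2 accounts for the coefficient of
    \<open>P k\<close> and for \<open>s n\<close>, and B + \<alpha>/4 for term \<open>k\<close>. The
    shift \<open>p\<close> makes the tail, at least (p/16) a_k^2, large enough to beat all of
    them.\<close>
  define p :: nat where "p = nat \<lceil>32 * (2 + B + \<alpha> / 4) / \<alpha>\<rceil> + 1"
  have p: "p \<ge> 1" "2 + B + \<alpha> / 4 \<le> \<alpha> / 2 * (p / 16)"
  proof -
    have "32 * (2 + B + \<alpha> / 4) / \<alpha> \<le> p" unfolding p_def by linarith
    then show "2 + B + \<alpha> / 4 \<le> \<alpha> / 2 * (p / 16)" using \<alpha> by (simp add: field_simps)
  qed (simp add: p_def)
  obtain S where S: "\<And>n. s n \<le> S" "S > 0"
    using convergent_imp_Bseq[OF convergentI[OF s]] by (auto simp: Bseq_def abs_le_iff)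
  \<comment> \<open>This scaling gives \<open>a 0\<close> the square \<open>S\<close>, a bound for
    all of \<open>s\<close>, so that block 0 can begin at index 0.\<close>
  define t where "t = sqrt S * (real p)\<^sup>2"
  define a where "a k = t / (real (k + p))\<^sup>2" for k
  have t: "t > 0" using S p by (simp add: t_def)
  have apos: "a k > 0" for k using t p by (simp add: a_def)
  have a0: "(a 0)\<^sup>2 = S" using S p by (simp add: a_def t_def)
  have asum: "(a k)\<^sup>2 * (2 + B + \<alpha> / 4) \<le> \<alpha> / 2 * (\<Sum>j\<in>{k+1..<K}. (a j)\<^sup>2)" if K: "K \<ge> 2 * k + p + 1" for k K
  proof -
    \<comment> \<open>In this range j + p is at most 2 (k + p), whence a_j is at least a_k/4; the
      range has k + p indices.\<close>
    have "(a k)\<^sup>2 / 16 \<le> (a j)\<^sup>2" if j: "j \<in> {k+1..<2*k+p+1}" for j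
    proof -
      have "real (j + p) \<le> 2 * real (k + p)" using j by simp
      then have "(real (j + p))\<^sup>2 \<le> (2 * real (k + p))\<^sup>2" by (intro power_mono) simp_all
      then have "t / (2 * real (k + p))\<^sup>2 \<le> t / (real (j + p))\<^sup>2"
        using t p by (intro divide_left_mono) auto
      moreover have "a k / 4 = t / (2 * real (k + p))\<^sup>2"
        unfolding a_def power_mult_distrib by simp
      ultimately have "a k / 4 \<le> a j" by (simp only: a_def)
      then have "(a k / 4)\<^sup>2 \<le> (a j)\<^sup>2" using apos[of k] by (intro power_mono) simp_all
      then show ?thesis by (simp add: power_divide)
    qed
    then have "(\<Sum>j\<in>{k+1..<2*k+p+1}. (a k)\<^sup>2 / 16) \<le> (\<Sum>j\<in>{k+1..<2*k+p+1}. (a j)\<^sup>2)" by (rule sum_mono)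
    also have "\<dots> \<le> (\<Sum>j\<in>{k+1..<K}. (a j)\<^sup>2)" using K by (intro sum_mono2) auto
    finally have "real (k + p) * ((a k)\<^sup>2 / 16) \<le> (\<Sum>j\<in>{k+1..<K}. (a j)\<^sup>2)" by simp
    moreover have "real p * ((a k)\<^sup>2 / 16) \<le> real (k + p) * ((a k)\<^sup>2 / 16)" by (intro mult_right_mono) auto
    ultimately have 1: "real p * ((a k)\<^sup>2 / 16) \<le> (\<Sum>j\<in>{k+1..<K}. (a j)\<^sup>2)" by linarith
    have "(a k)\<^sup>2 * (2 + B + \<alpha> / 4) \<le> (a k)\<^sup>2 * (\<alpha> / 2 * (p / 16))" using p(2) by (intro mult_left_mono) auto
    also have "\<dots> = \<alpha> / 2 * (real p * ((a k)\<^sup>2 / 16))" by simp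
    also have "\<dots> \<le> \<alpha> / 2 * (\<Sum>j\<in>{k+1..<K}. (a j)\<^sup>2)" using 1 \<alpha> by (intro mult_left_mono) auto
    finally show ?thesis .
  qed
  \<comment> \<open>\<open>M\<close> is chosen first, using the decay of the coefficients of
    \<open>P\<close> and of \<open>s\<close>. Then \<open>i\<close> is taken so large that the
    finitely many coefficients up to \<open>M\<close> are near their limits and the cross term is
    small for all \<open>n\<close>.\<close>
  have step: "\<exists>M i. M \<ge> k \<and> (\<forall>n\<ge>M. cmod (autocorr w n P) \<le> (a k)\<^sup>2 \<and> s n \<le> (a k)\<^sup>2) \<and>
      (\<forall>n\<le>M. cmod (autocorr w n (u i) - of_real \<alpha> * cnj v0 ^ n) \<le> \<alpha> / 4) \<and>
      (\<forall>n. cmod (autocorr w n (\<lambda>l. P l + of_real (a k) * u i l) - autocorr w n P - of_real ((a k)\<^sup>2) * autocorr w n (u i))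
         \<le> (a k)\<^sup>2 * \<alpha> / 4)" if P: "bdd_on_circle P" for k P
  proof -
    from P obtain C where C: "\<And>l. l \<in> circle \<Longrightarrow> cmod (P l) \<le> C" "C \<ge> 0" by (metis bdd_on_circleE)
    have ak: "(a k)\<^sup>2 > 0" using apos[of k] by simp
    have "\<forall>\<^sub>F n in sequentially. cmod (autocorr w n P) < (a k)\<^sup>2 \<and> s n < (a k)\<^sup>2"
      using order_tendstoD(2)[OF tendsto_norm_zero[OF autocorr_tendsto_0[OF P]] ak] order_tendstoD(2)[OF s ak]
      by (rule eventually_conj)
    then obtain M0 where M0: "\<forall>n\<ge>M0. cmod (autocorr w n P) < (a k)\<^sup>2 \<and> s n < (a k)\<^sup>2"
      unfolding eventually_sequentially by blast
    \<comment> \<open>The maximum with \<open>k\<close> makes the block starts tend to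
      infinity.\<close>
    define M where "M = max M0 k"
    have ev1: "\<forall>\<^sub>F i in sequentially. \<forall>n\<in>{..M}. cmod (autocorr w n (u i) - of_real \<alpha> * cnj v0 ^ n) < \<alpha> / 4"
      unfolding eventually_ball_finite_distrib[OF finite_atMost]
    proof
      fix n assume "n \<in> {..M}"
      have "(\<lambda>i. cmod (autocorr w n (u i) - of_real \<alpha> * cnj v0 ^ n)) \<longlonglongrightarrow> 0"
        using P2[of n] by (intro tendsto_norm_zero) (simp add: LIM_zero)
      then show "\<forall>\<^sub>F i in sequentially. cmod (autocorr w n (u i) - of_real \<alpha> * cnj v0 ^ n) < \<alpha> / 4"
        by (rule order_tendstoD) (use \<alpha> in simp)
    qed
    have "(\<lambda>i. 2 * \<bar>a k\<bar> * C * B * (\<integral>l. cmod (u i l) \<partial>circle_measure)) \<longlonglongrightarrow> 0"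
      using tendsto_mult_left[OF P3, of "2 * \<bar>a k\<bar> * C * B"] by simp
    then have ev2: "\<forall>\<^sub>F i in sequentially. 2 * \<bar>a k\<bar> * C * B * (\<integral>l. cmod (u i l) \<partial>circle_measure) < (a k)\<^sup>2 * \<alpha> / 4"
      by (rule order_tendstoD) (use \<alpha> ak in simp)
    obtain i where i1: "\<forall>n\<in>{..M}. cmod (autocorr w n (u i) - of_real \<alpha> * cnj v0 ^ n) < \<alpha> / 4"
      and i2: "2 * \<bar>a k\<bar> * C * B * (\<integral>l. cmod (u i l) \<partial>circle_measure) < (a k)\<^sup>2 * \<alpha> / 4"
      using eventually_happens'[OF _ eventually_conj[OF ev1 ev2]] by auto
    show ?thesis
    proof (rule exI[of _ M], rule exI[of _ i], intro conjI allI impI)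
      fix n
      show "cmod (autocorr w n (\<lambda>l. P l + of_real (a k) * u i l) - autocorr w n P - of_real ((a k)\<^sup>2) * autocorr w n (u i))
         \<le> (a k)\<^sup>2 * \<alpha> / 4"
        using autocorr_add_mult[OF P u[of i] C(1), where a="a k" and n=n] i2 by linarith
    qed (use M0 i1 in \<open>auto simp: M_def less_imp_le\<close>)
  qed
  define \<Phi> where "\<Phi> k P M i \<longleftrightarrow> M \<ge> k \<and> (\<forall>n\<ge>M. cmod (autocorr w n P) \<le> (a k)\<^sup>2 \<and> s n \<le> (a k)\<^sup>2) \<and>
      (\<forall>n\<le>M. cmod (autocorr w n (u i) - of_real \<alpha> * cnj v0 ^ n) \<le> \<alpha> / 4) \<and>
      (\<forall>n. cmod (autocorr w n (\<lambda>l. P l + of_real (a k) * u i l) - autocorr w n P - of_real ((a k)\<^sup>2) * autocorr w n (u i))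
         \<le> (a k)\<^sup>2 * \<alpha> / 4)" for k P M i
  \<comment> \<open>The choice is made a function of the stage and of the polynomial built so far,
    so that the sequence \<open>P\<close> can be defined by primitive recursion.\<close>
  define MI where "MI k P = (SOME x. \<Phi> k P (fst x) (snd x))" for k P
  define MM II where "MM k P = fst (MI k P)" and "II k P = snd (MI k P)" for k P
  have MI: "\<Phi> k P (MM k P) (II k P)" if good: "bdd_on_circle P" for k P
  proof -
    obtain M i where "\<Phi> k P M i" using step[OF good, of k] unfolding \<Phi>_def[symmetric] by blast
    then have "\<Phi> k P (fst (M, i)) (snd (M, i))" by simp
    then show ?thesis unfolding MM_def II_def MI_def by (rule someI)
  qed
  define P where "P = rec_nat (\<lambda>l. 0) (\<lambda>k Q l. Q l + of_real (a k) * u (II k Q) l)"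
  have P0: "P 0 = (\<lambda>l. 0)" and PSuc: "P (Suc k) = (\<lambda>l. P k l + of_real (a k) * u (II k (P k)) l)" for k
    by (simp_all add: P_def)
  define i where "i k = II k (P k)" for k
  \<comment> \<open>The start of block 0 is set to 0 instead of the chosen value: \<open>P 0\<close>
    vanishes and the square of \<open>a 0\<close> bounds every \<open>s n\<close>.\<close>
  define M where "M k = (if k = 0 then 0 else MM k (P k))" for k
  have Pbdd: "bdd_on_circle (P k)" for k
  proof (induction k)
    case 0
    show ?case by (auto simp: P0 bdd_on_circle_def)
  next
    case (Suc k)
    then show ?case unfolding PSuc by (rule bdd_on_circle_add_mult) (rule u)
  qed
  have Psum: "P K = (\<lambda>l. \<Sum>k<K. of_real (a k) * u (i k) l)" for K
    by (induction K) (auto simp: P0 PSuc i_def)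
  have Mge: "M k \<ge> k" for k using MI[OF Pbdd, of k k] by (auto simp: M_def \<Phi>_def)
  have small: "cmod (autocorr w n (P k)) \<le> (a k)\<^sup>2 \<and> s n \<le> (a k)\<^sup>2" if "n \<ge> M k" for n k
  proof (cases "k = 0")
    case True
    then show ?thesis using S a0 by (simp add: P0 autocorr_def)
  next
    case False
    then show ?thesis using MI[OF Pbdd, of k k] that by (auto simp: M_def \<Phi>_def)
  qed
  define \<Delta> where "\<Delta> n j = autocorr w n (P (Suc j)) - autocorr w n (P j)" for n j
  have near: "cmod (\<Delta> n j - of_real ((a j)\<^sup>2) * autocorr w n (u (i j))) \<le> (a j)\<^sup>2 * \<alpha> / 4" for n j
    using MI[OF Pbdd, of j j] by (auto simp: \<Delta>_def PSuc i_def \<Phi>_def)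
  have main: "s n \<le> cmod (autocorr w n (P K))" if K: "K \<ge> 2 * k + p + 1" and kn: "M k \<le> n" "\<And>j. j > k \<Longrightarrow> n < M j" for n k K
  proof -
    have un: "cmod (autocorr w n (u j)) \<le> B" for j
      using norm_autocorr_le[OF u, of n j] P1[of j] by linarith
    \<comment> \<open>Here \<open>n\<close> may lie beyond the range in which \<open>u (i k)\<close>
      was matched to its limit, so only the trivial bound \<open>B\<close> is available for its
      coefficient.\<close>
    have \<Delta>k: "cmod (\<Delta> n k) \<le> (a k)\<^sup>2 * (B + \<alpha> / 4)"
    proof -
      have "cmod (\<Delta> n k) \<le> cmod (\<Delta> n k - of_real ((a k)\<^sup>2) * autocorr w n (u (i k))) + cmod (of_real ((a k)\<^sup>2) * autocorr w n (u (i k)))"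
        using norm_triangle_ineq[of "\<Delta> n k - of_real ((a k)\<^sup>2) * autocorr w n (u (i k))" "of_real ((a k)\<^sup>2) * autocorr w n (u (i k))"]
        by (simp only: diff_add_cancel)
      also have "\<dots> \<le> (a k)\<^sup>2 * \<alpha> / 4 + (a k)\<^sup>2 * B"
        using near[of n k] un[of "i k"] by (intro add_mono) (auto simp: norm_mult norm_power intro!: mult_left_mono)
      finally show ?thesis by (simp add: algebra_simps)
    qed
    \<comment> \<open>Since n < M j, the coefficient of \<open>u (i j)\<close> is within \<alpha>/4
      of its limit; the cross term accounts for the other \<alpha>/4.\<close>
    have \<Delta>j: "cmod (\<Delta> n j - of_real ((a j)\<^sup>2) * (of_real \<alpha> * cnj v0 ^ n)) \<le> (a j)\<^sup>2 * \<alpha> / 2" if j: "j > k" for j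
    proof -
      have "n \<le> MM j (P j)" using kn(2)[OF j] j by (simp add: M_def)
      then have "cmod (autocorr w n (u (i j)) - of_real \<alpha> * cnj v0 ^ n) \<le> \<alpha> / 4"
        using MI[OF Pbdd, of j j] by (auto simp: i_def \<Phi>_def)
      then have "(a j)\<^sup>2 * cmod (autocorr w n (u (i j)) - of_real \<alpha> * cnj v0 ^ n) \<le> (a j)\<^sup>2 * (\<alpha> / 4)"
        by (rule mult_left_mono) simp
      then have "cmod (of_real ((a j)\<^sup>2) * autocorr w n (u (i j)) - of_real ((a j)\<^sup>2) * (of_real \<alpha> * cnj v0 ^ n)) \<le> (a j)\<^sup>2 * \<alpha> / 4"
        by (simp add: norm_mult norm_power flip: right_diff_distrib)
      from norm_diff_triangle_le[OF near[of n j] this] show ?thesis by (simp add: mult.commute)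
    qed
    define \<sigma> where "\<sigma> = (\<Sum>j\<in>{k+1..<K}. (a j)\<^sup>2)"
    have \<sigma>: "0 \<le> \<sigma>" unfolding \<sigma>_def by (rule sum_nonneg) simp
    \<comment> \<open>All later terms share the phase \<open>cnj v0 ^ n\<close>, so they cannot
      cancel: the tail keeps modulus at least half of \<alpha> \<sigma>.\<close>
    have "cmod ((\<Sum>j\<in>{k+1..<K}. \<Delta> n j) - of_real \<sigma> * (of_real \<alpha> * cnj v0 ^ n))
       = cmod (\<Sum>j\<in>{k+1..<K}. \<Delta> n j - of_real ((a j)\<^sup>2) * (of_real \<alpha> * cnj v0 ^ n))"
      by (simp add: \<sigma>_def sum_subtractf sum_distrib_right)
    also have "\<dots> \<le> (\<Sum>j\<in>{k+1..<K}. (a j)\<^sup>2 * \<alpha> / 2)"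
      by (rule sum_norm_le) (use \<Delta>j in simp)
    also have "\<dots> = \<alpha> / 2 * \<sigma>" by (simp add: \<sigma>_def sum_distrib_left mult.commute)
    finally have 1: "cmod ((\<Sum>j\<in>{k+1..<K}. \<Delta> n j) - of_real \<sigma> * (of_real \<alpha> * cnj v0 ^ n)) \<le> \<alpha> / 2 * \<sigma>" .
    have 2: "cmod (of_real \<sigma> * (of_real \<alpha> * cnj v0 ^ n)) = \<alpha> * \<sigma>"
      using v0 \<alpha> \<sigma> by (simp add: norm_mult norm_power circle_def)
    have tele: "autocorr w n (P K) = autocorr w n (P k) + \<Delta> n k + (\<Sum>j\<in>{k+1..<K}. \<Delta> n j)"
    proof -
      have "(\<Sum>j\<in>{k+1..<K}. \<Delta> n j) = autocorr w n (P K) - autocorr w n (P (k+1))"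
        unfolding \<Delta>_def using K by (intro sum_Suc_diff') simp
      then show ?thesis by (simp add: \<Delta>_def)
    qed
    have "\<alpha> * \<sigma> - \<alpha> / 2 * \<sigma> \<le> cmod (\<Sum>j\<in>{k+1..<K}. \<Delta> n j)"
      using 1 2 norm_triangle_ineq2[of "of_real \<sigma> * (of_real \<alpha> * cnj v0 ^ n)" "\<Sum>j\<in>{k+1..<K}. \<Delta> n j"]
      by (simp add: norm_minus_commute)
    moreover have "cmod (\<Sum>j\<in>{k+1..<K}. \<Delta> n j) \<le> cmod (autocorr w n (P K)) + (cmod (autocorr w n (P k)) + cmod (\<Delta> n k))"
    proof -
      have "(\<Sum>j\<in>{k+1..<K}. \<Delta> n j) = autocorr w n (P K) - (autocorr w n (P k) + \<Delta> n k)" by (simp add: tele)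
      then show ?thesis
        using norm_triangle_ineq4[of "autocorr w n (P K)" "autocorr w n (P k) + \<Delta> n k"]
          norm_triangle_ineq[of "autocorr w n (P k)" "\<Delta> n k"] by simp
    qed
    moreover have "(a k)\<^sup>2 * (2 + B + \<alpha> / 4) \<le> \<alpha> / 2 * \<sigma>" unfolding \<sigma>_def by (rule asum[OF K])
    moreover have "(a k)\<^sup>2 * (2 + B + \<alpha> / 4) = 2 * (a k)\<^sup>2 + (a k)\<^sup>2 * (B + \<alpha> / 4)" by (simp add: algebra_simps)
    moreover have "\<alpha> * \<sigma> - \<alpha> / 2 * \<sigma> = \<alpha> / 2 * \<sigma>" by simp
    ultimately show ?thesis using small[OF kn(1)] \<Delta>k by linarith
  qed
  have fin: "\<forall>\<^sub>F K in sequentially. s n \<le> cmod (autocorr w n (P K))" for n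
  proof -
    \<comment> \<open>The last block starting at or before \<open>n\<close>: the set is finite
      because \<open>M k \<ge> k\<close>, and nonempty because \<open>M 0\<close> is 0.\<close>
    define k where "k = Max {k. M k \<le> n}"
    have fin: "finite {k. M k \<le> n}"
      by (rule finite_subset[of _ "{..n}"]) (use Mge order_trans in auto)
    have "{k. M k \<le> n} \<noteq> {}" by (auto simp: M_def intro: exI[of _ 0])
    then have "M k \<le> n" using Max_in[OF fin] by (simp add: k_def)
    moreover have "n < M j" if "j > k" for j
      using Max_ge[OF fin, of j] that by (auto simp: k_def not_le[symmetric])
    ultimately show ?thesis
      using main[of k _ n] unfolding eventually_sequentially by blast
  qed
  have "\<bar>a k\<bar> \<le> t / (real k + 1)\<^sup>2" for k
  proof -
    have "(real k + 1)\<^sup>2 \<le> (real (k + p))\<^sup>2" using p by (intro power_mono) simp_all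
    then show ?thesis using t apos[of k] by (simp add: a_def frac_le)
  qed
  then show ?thesis using fin unfolding Psum by blast
qed

end

section \<open>Gaussian series\<close>

text \<open>By monotone convergence the sum of the series has finite integral, so it is finite
  almost everywhere.\<close>

lemma AE_summable_of_summable_integral:
  fixes f :: "nat \<Rightarrow> 'a \<Rightarrow> real"
  assumes int: "\<And>k. integrable M (f k)" and nn: "\<And>k z. 0 \<le> f k z"
    and sm: "summable (\<lambda>k. \<integral>z. f k z \<partial>M)"
  shows "AE z in M. summable (\<lambda>k. f k z)"
proof -
  have [measurable]: "f k \<in> borel_measurable M" for k using int by (rule borel_measurable_integrable)
  have eq: "(\<integral>\<^sup>+z. (\<Sum>k. ennreal (f k z)) \<partial>M) = (\<Sum>k. ennreal (\<integral>z. f k z \<partial>M))"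
    by (simp add: nn_integral_suminf nn_integral_eq_integral int nn)
  have "(\<Sum>k. ennreal (\<integral>z. f k z \<partial>M)) \<noteq> \<infinity>"
    unfolding infinity_ennreal_def
    by (rule ennreal_suminf_neq_top[OF sm]) (intro integral_nonneg_AE always_eventually allI nn)
  then have "AE z in M. (\<Sum>k. ennreal (f k z)) \<noteq> \<infinity>"
    by (intro nn_integral_PInf_AE) (simp_all only: eq, measurable)
  then show ?thesis by eventually_elim (rule summable_suminf_not_top, simp_all add: nn)
qed

lemma summable_inverse_square: "summable (\<lambda>k. 1 / (real k + 1)\<^sup>2)"
proof -
  have "summable (\<lambda>k. inverse ((real (Suc k))\<^sup>2))"
    using inverse_power_summable[of 2, where 'a=real] by (subst summable_Suc_iff) simp_all
  then show ?thesis by (simp add: inverse_eq_divide add.commute)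
qed

text \<open>Writing |d_k| as 1/(k+1) times (k+1)|d_k|, Cauchy-Schwarz bounds all partial sums by a
  multiple of the sum of (k+1)^2 |d_k|^2. The integrals of these terms are at most C/(k+1)^2, so the
  sum is integrable.\<close>

lemma weighted_L2_series_dominated:
  fixes d :: "nat \<Rightarrow> 'a \<Rightarrow> complex"
  assumes int: "\<And>k. integrable M (\<lambda>z. (cmod (d k z))\<^sup>2)"
    and le: "\<And>k. (\<integral>z. (cmod (d k z))\<^sup>2 \<partial>M) \<le> C / (real k + 1) ^ 4"
  obtains D where "integrable M D"
    "AE z in M. summable (\<lambda>k. d k z) \<and> (\<forall>K. (cmod (\<Sum>k<K. d k z))\<^sup>2 \<le> D z)"
proof -
  define c where "c = (\<Sum>k. 1 / (real k + 1)\<^sup>2)"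
  define f where "f k z = (real k + 1)\<^sup>2 * (cmod (d k z))\<^sup>2" for k z
  have fint: "integrable M (f k)" for k unfolding f_def by (intro integrable_mult_right int)
  have fnn: "0 \<le> f k z" for k z by (simp add: f_def)
  have C: "0 \<le> C"
    using order_trans[OF integral_nonneg_AE le[of 0]] by simp
  have fle: "(\<integral>z. f k z \<partial>M) \<le> C * (1 / (real k + 1)\<^sup>2)" for k
  proof -
    have "(\<integral>z. f k z \<partial>M) = (real k + 1)\<^sup>2 * (\<integral>z. (cmod (d k z))\<^sup>2 \<partial>M)" by (simp add: f_def)
    also have "\<dots> \<le> (real k + 1)\<^sup>2 * (C / (real k + 1) ^ 4)" by (intro mult_left_mono le) simp
    also have "\<dots> = C * (1 / (real k + 1)\<^sup>2)"
    proof -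
      have "r\<^sup>2 * (C / r ^ 4) = C * (1 / r\<^sup>2)" if "r > 0" for r
        using that by (simp add: field_simps power2_eq_square power4_eq_xxxx)
      then show ?thesis by simp
    qed
    finally show ?thesis .
  qed
  have fsm: "summable (\<lambda>k. \<integral>z. f k z \<partial>M)"
    by (rule summable_comparison_test'[OF summable_mult[OF summable_inverse_square, of C], of 0])
       (use fle fnn in \<open>auto simp: abs_of_nonneg\<close>)
  have AEs: "AE z in M. summable (\<lambda>k. f k z)"
    by (rule AE_summable_of_summable_integral[OF fint fnn fsm])
  show thesis
  proof (rule that[of "\<lambda>z. c * (\<Sum>k. f k z)"])
    show "integrable M (\<lambda>z. c * (\<Sum>k. f k z))"
      using AEs fsm by (intro integrable_mult_right integrable_suminf fint) (auto simp: fnn abs_of_nonneg)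
    show "AE z in M. summable (\<lambda>k. d k z) \<and> (\<forall>K. (cmod (\<Sum>k<K. d k z))\<^sup>2 \<le> c * (\<Sum>k. f k z))"
      using AEs
    proof eventually_elim
      case (elim z)
      have le': "(\<Sum>k<K. cmod (d k z))\<^sup>2 \<le> c * (\<Sum>k. f k z)" for K
      proof -
        have "(\<Sum>k<K. cmod (d k z))\<^sup>2 = (\<Sum>k<K. (1 / (real k + 1)) * ((real k + 1) * cmod (d k z)))\<^sup>2"
          by (intro arg_cong[where f="\<lambda>x. x\<^sup>2"] sum.cong) auto
        also have "\<dots> \<le> (\<Sum>k<K. (1 / (real k + 1))\<^sup>2) * (\<Sum>k<K. ((real k + 1) * cmod (d k z))\<^sup>2)"
          by (rule Cauchy_Schwarz_ineq_sum)
        also have "\<dots> = (\<Sum>k<K. 1 / (real k + 1)\<^sup>2) * (\<Sum>k<K. f k z)"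
          by (simp add: f_def power_mult_distrib power_divide)
        also have "\<dots> \<le> c * (\<Sum>k. f k z)"
          unfolding c_def using elim fnn
          by (intro mult_mono sum_le_suminf summable_inverse_square sum_nonneg suminf_nonneg) auto
        finally show ?thesis .
      qed
      have sum_le: "(\<Sum>k<K. norm (d k z)) \<le> sqrt (c * (\<Sum>k. f k z))" for K
        using le'[of K] by (intro real_le_rsqrt) simp
      have "summable (\<lambda>k. norm (d k z))"
      proof (rule bounded_imp_summable)
        show "(\<Sum>k\<le>n. norm (d k z)) \<le> sqrt (c * (\<Sum>k. f k z))" for n
          using sum_le[of "Suc n"] by (simp only: lessThan_Suc_atMost)
      qed simp
      moreover have "(cmod (\<Sum>k<K. d k z))\<^sup>2 \<le> c * (\<Sum>k. f k z)" for K
        by (rule order_trans[OF power_mono[OF norm_sum] le']) simp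
      ultimately show ?case by (auto intro: summable_norm_cancel)
    qed
  qed
qed

lemma norm_diff_square_le: "(norm (a - b))\<^sup>2 \<le> 2 * (norm a)\<^sup>2 + 2 * (norm (b::'a::real_normed_vector))\<^sup>2"
proof -
  have "(norm (a - b))\<^sup>2 \<le> (norm a + norm b)\<^sup>2" by (intro power_mono norm_triangle_ineq4) simp
  also have "\<dots> \<le> 2 * (norm a)\<^sup>2 + 2 * (norm b)\<^sup>2"
    using zero_le_power2[of "norm a - norm b"] by (simp add: power2_eq_square algebra_simps)
  finally show ?thesis .
qed

section \<open>Linear functionals under the Gaussian measure\<close>

locale gaussian_eigenfield =
  fixes T S :: "'a::complex_hilbert \<Rightarrow> 'a" and E :: "complex \<Rightarrow> 'a" and R :: "'a \<Rightarrow> 'a" and m :: "'a measure"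
    and CE :: real
  assumes T_cont: "continuous_on UNIV T"
    and S: "\<And>x z. cinner (S x) z = cinner x (T z)"
    and CE: "\<And>l. l \<in> circle \<Longrightarrow> norm (E l) \<le> CE"
    and TE: "\<And>l. l \<in> circle \<Longrightarrow> T (E l) = cscale l (E l)"
    and E_meas [measurable]: "\<And>x. (\<lambda>l. cinner x (E l)) \<in> borel_measurable borel"
    and R: "\<And>x y. cinner (R x) y = (\<integral>l. cinner x (E l) * cnj (cinner y (E l)) \<partial>circle_measure)"
    and m: "gaussian_measure_with_cov m R"
begin

sublocale m: prob_space m
  using m by (simp add: gaussian_measure_with_cov_def)

lemma sets_m [measurable_cong, simp]: "sets m = sets borel"
  using m by (simp add: gaussian_measure_with_cov_def)

lemma space_m [simp]: "space m = UNIV"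
  using sets_eq_imp_space_eq[OF sets_m] by simp

lemma distr_m: "distr m borel (cinner x) = complex_gaussian (Re (cinner (R x) x))"
  and covariance: "(\<integral>z. cinner x z * cnj (cinner y z) \<partial>m) = cinner (R x) y"
  using m by (simp_all add: gaussian_measure_with_cov_def)

lemma CE_nonneg: "0 \<le> CE"
  using CE[of 1] order_trans[OF norm_ge_zero] by (auto simp: circle_def)

lemma cinner_E_le: "l \<in> circle \<Longrightarrow> cmod (cinner x (E l)) \<le> norm x * CE"
  by (rule order_trans[OF cinner_Cauchy_Schwarz]) (intro mult_left_mono CE norm_ge_zero)

text \<open>The isometry between L2(m) and L2(mu): both sides are <R x, x>.\<close>

lemma integral_cinner_square_m:
  "(\<integral>z. (cmod (cinner x z))\<^sup>2 \<partial>m) = (\<integral>l. (cmod (cinner x (E l)))\<^sup>2 \<partial>circle_measure)"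
proof -
  have "complex_of_real (\<integral>z. (cmod (cinner x z))\<^sup>2 \<partial>m) = (\<integral>z. cinner x z * cnj (cinner x z) \<partial>m)"
    by (subst integral_complex_of_real[symmetric]) (simp add: complex_norm_square del: of_real_power)
  also have "\<dots> = (\<integral>l. cinner x (E l) * cnj (cinner x (E l)) \<partial>circle_measure)"
    by (simp add: covariance R)
  also have "\<dots> = complex_of_real (\<integral>l. (cmod (cinner x (E l)))\<^sup>2 \<partial>circle_measure)"
    by (subst integral_complex_of_real[symmetric]) (simp add: complex_norm_square del: of_real_power)
  finally show ?thesis using of_real_eq_iff by blast
qed

text \<open>A nonzero second moment forces integrability, since non-integrable functions have integral
  zero; a zero one means that the law of \<open>\<langle>x, \<cdot>\<rangle>\<close> is the Dirac mass at \<open>0\<close>.\<close>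

lemma integrable_cinner_square_m: "integrable m (\<lambda>z. (cmod (cinner x z))\<^sup>2)"
proof (cases "(\<integral>z. (cmod (cinner x z))\<^sup>2 \<partial>m) = 0")
  case False
  then show ?thesis using not_integrable_integral_eq by blast
next
  case True
  have "(\<integral>z. cinner x z * cnj (cinner x z) \<partial>m) = complex_of_real (\<integral>z. (cmod (cinner x z))\<^sup>2 \<partial>m)"
    by (subst integral_complex_of_real[symmetric]) (simp add: complex_norm_square del: of_real_power)
  then have eq: "distr m borel (cinner x) = return borel 0"
    unfolding distr_m covariance by (simp add: complex_gaussian_def True)
  have "AE y in distr m borel (cinner x). y = 0"
    unfolding eq by (subst AE_return) simp_all
  then have ae: "AE z in m. cinner x z = 0" by (subst (asm) AE_distr_iff) simp_all
  have "integrable m (\<lambda>z. (cmod (cinner x z))\<^sup>2) \<longleftrightarrow> integrable m (\<lambda>z. 0::real)"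
    by (rule integrable_cong_AE) (use ae in \<open>auto elim!: eventually_mono\<close>)
  then show ?thesis by simp
qed

lemma integrable_cinner_m: "integrable m (cinner x)"
proof (rule Bochner_Integration.integrable_bound[of _ "\<lambda>z. 1 + (cmod (cinner x z))\<^sup>2"])
  show "integrable m (\<lambda>z. 1 + (cmod (cinner x z))\<^sup>2)"
    using integrable_cinner_square_m by simp
  have "t \<le> 1 + t\<^sup>2" for t :: real using zero_le_power2[of "t - 1 / 2"] by (simp add: power2_eq_square algebra_simps)
  then show "AE z in m. norm (cinner x z) \<le> norm (1 + (cmod (cinner x z))\<^sup>2)" by (simp add: abs_of_nonneg)
qed simp

text \<open>Replacing \<open>x\<close> by \<open>- x\<close> keeps the variance and therefore the
  law, so the mean equals its own negative.\<close>

lemma integral_cinner_m: "(\<integral>z. cinner x z \<partial>m) = 0"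
proof -
  have "cinner (R (- x)) (- x) = cinner (R x) x"
    unfolding R by (simp add: cinner_minus_left)
  then have "distr m borel (cinner (- x)) = distr m borel (cinner x)" by (simp only: distr_m)
  then have "(\<integral>w. w \<partial>distr m borel (cinner (- x))) = (\<integral>w. w \<partial>distr m borel (cinner x))" by simp
  then have "(\<integral>z. cinner (- x) z \<partial>m) = (\<integral>z. cinner x z \<partial>m)"
    by (simp add: integral_distr)
  then show ?thesis by (simp add: cinner_minus_left)
qed

lemma T_funpow_continuous: "continuous_on UNIV (T ^^ n)"
proof (induction n)
  case (Suc n)
  then show ?case using continuous_on_compose[OF Suc continuous_on_subset[OF T_cont]] by simp
qed (simp add: continuous_on_id id_def)

lemma T_funpow_measurable [measurable]: "T ^^ n \<in> borel_measurable borel"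
  by (intro borel_measurable_continuous_onI T_funpow_continuous)

lemma cinner_S_funpow: "cinner ((S ^^ n) x) z = cinner x ((T ^^ n) z)"
  by (induction n arbitrary: z) (simp_all add: S funpow_swap1[of T])

text \<open>The eigenvector equation turns powers of the adjoint into multiplication by powers of
  \<open>l\<close>, so polynomials in \<open>S\<close> act on <x, E> as analytic
  polynomials.\<close>

lemma cinner_S_funpow_E:
  assumes l: "l \<in> circle"
  shows "cinner ((S ^^ n) x) (E l) = l ^ n * cinner x (E l)"
  by (induction n) (simp_all add: S TE[OF l] cinner_cscale_right)

lemma integral_cinner_S_funpow_E:
  "(\<integral>l. (cmod (cinner ((S ^^ n) x) (E l)))\<^sup>2 \<partial>circle_measure) = (\<integral>l. (cmod (cinner x (E l)))\<^sup>2 \<partial>circle_measure)"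
  by (rule integral_circle_cong) (auto simp: cinner_S_funpow_E norm_mult norm_power circle_def)

text \<open>Norm convergence of vectors thus implies L2(m) convergence of the functionals they
  define, which links the closed span of the basis to \<open>G_C\<close>.\<close>

lemma integral_cinner_square_m_le: "(\<integral>z. (cmod (cinner x z))\<^sup>2 \<partial>m) \<le> (norm x * CE)\<^sup>2"
proof -
  have "(\<integral>l. (cmod (cinner x (E l)))\<^sup>2 \<partial>circle_measure) \<le> (\<integral>l. (norm x * CE)\<^sup>2 \<partial>circle_measure)"
    by (intro integral_circle_mono integrable_circle[where B="(norm x * CE)\<^sup>2"])
       (auto intro!: power_mono cinner_E_le)
  then show ?thesis using circle_measure.prob_space by (simp add: integral_cinner_square_m)
qed

section \<open>Series of linear functionals\<close>

context
  fixes y :: "nat \<Rightarrow> 'a" and C :: real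
  assumes y: "\<And>k. (\<integral>l. (cmod (cinner (y k) (E l)))\<^sup>2 \<partial>circle_measure) \<le> C / (real k + 1) ^ 4"
begin

text \<open>Since \<open>S ^^ n\<close> multiplies <y k, E> by a unimodular function, the moment
  bounds are the same for every \<open>n\<close>.\<close>

lemma series_dominated:
  obtains D where "integrable m D"
    "AE z in m. summable (\<lambda>k. cinner ((S ^^ n) (y k)) z) \<and> (\<forall>K. (cmod (\<Sum>k<K. cinner ((S ^^ n) (y k)) z))\<^sup>2 \<le> D z)"
proof (rule weighted_L2_series_dominated[of m "\<lambda>k. cinner ((S ^^ n) (y k))" C])
  show "integrable m (\<lambda>z. (cmod (cinner ((S ^^ n) (y k)) z))\<^sup>2)" for k
    by (rule integrable_cinner_square_m)
  show "(\<integral>z. (cmod (cinner ((S ^^ n) (y k)) z))\<^sup>2 \<partial>m) \<le> C / (real k + 1) ^ 4" for k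
    unfolding integral_cinner_square_m integral_cinner_S_funpow_E by (rule y)
qed

text \<open>The pointwise sum is a representative defined everywhere, which can be evaluated at
  \<open>(T ^^ n) z\<close>; for each \<open>n\<close> the series converges there for almost every
  \<open>z\<close>.\<close>

definition "gauss_series z = (\<Sum>k. cinner (y k) z)"

lemma gauss_series_measurable [measurable]: "gauss_series \<in> borel_measurable borel"
  unfolding gauss_series_def by measurable

text \<open>Provides one integrable majorant for the series at \<open>z\<close> and at
  \<open>(T ^^ n) z\<close>, the maximum of the two individual ones; the limit inherits the bound
  from the partial sums.\<close>

lemma gauss_series_dominated:
  obtains D where "integrable m D"
    "AE z in m. (\<lambda>K. \<Sum>k<K. cinner (y k) z) \<longlonglongrightarrow> gauss_series z \<and> (\<forall>K. (cmod (\<Sum>k<K. cinner (y k) z))\<^sup>2 \<le> D z)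
      \<and> (cmod (gauss_series z))\<^sup>2 \<le> D z"
    "AE z in m. (\<lambda>K. \<Sum>k<K. cinner (y k) ((T ^^ n) z)) \<longlonglongrightarrow> gauss_series ((T ^^ n) z)
      \<and> (\<forall>K. (cmod (\<Sum>k<K. cinner (y k) ((T ^^ n) z)))\<^sup>2 \<le> D z)"
proof -
  have lim: "(\<lambda>K. \<Sum>k<K. f k) \<longlonglongrightarrow> suminf f" if "summable f" for f :: "nat \<Rightarrow> complex"
    using summable_sums[OF that] by (simp add: sums_def)
  obtain D0 where D0: "integrable m D0"
    "AE z in m. summable (\<lambda>k. cinner (y k) z) \<and> (\<forall>K. (cmod (\<Sum>k<K. cinner (y k) z))\<^sup>2 \<le> D0 z)"
    by (rule series_dominated[of 0, unfolded funpow_0])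
  obtain D1 where D1: "integrable m D1"
    "AE z in m. summable (\<lambda>k. cinner (y k) ((T ^^ n) z)) \<and> (\<forall>K. (cmod (\<Sum>k<K. cinner (y k) ((T ^^ n) z)))\<^sup>2 \<le> D1 z)"
    by (rule series_dominated[of n, unfolded cinner_S_funpow])
  show thesis
  proof (rule that[of "\<lambda>z. max (D0 z) (D1 z)"])
    show "integrable m (\<lambda>z. max (D0 z) (D1 z))" using D0 D1 by (intro integrable_max)
    show "AE z in m. (\<lambda>K. \<Sum>k<K. cinner (y k) z) \<longlonglongrightarrow> gauss_series z \<and> (\<forall>K. (cmod (\<Sum>k<K. cinner (y k) z))\<^sup>2 \<le> max (D0 z) (D1 z))
        \<and> (cmod (gauss_series z))\<^sup>2 \<le> max (D0 z) (D1 z)"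
      using D0(2)
    proof eventually_elim
      case (elim z)
      then have l: "(\<lambda>K. \<Sum>k<K. cinner (y k) z) \<longlonglongrightarrow> gauss_series z" by (simp add: gauss_series_def lim)
      have le: "(cmod (\<Sum>k<K. cinner (y k) z))\<^sup>2 \<le> max (D0 z) (D1 z)" for K
        using elim by (simp add: le_max_iff_disj)
      have "(\<lambda>K. (cmod (\<Sum>k<K. cinner (y k) z))\<^sup>2) \<longlonglongrightarrow> (cmod (gauss_series z))\<^sup>2"
        by (intro tendsto_intros l)
      then have "(cmod (gauss_series z))\<^sup>2 \<le> max (D0 z) (D1 z)"
        by (rule LIMSEQ_le_const2) (use le in blast)
      then show ?case using l le by blast
    qed
    show "AE z in m. (\<lambda>K. \<Sum>k<K. cinner (y k) ((T ^^ n) z)) \<longlonglongrightarrow> gauss_series ((T ^^ n) z)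
      \<and> (\<forall>K. (cmod (\<Sum>k<K. cinner (y k) ((T ^^ n) z)))\<^sup>2 \<le> max (D0 z) (D1 z))"
      using D1(2) by eventually_elim (auto simp: gauss_series_def lim le_max_iff_disj)
  qed
qed

lemma integrable_gauss_series_square: "integrable m (\<lambda>z. (cmod (gauss_series z))\<^sup>2)"
proof -
  obtain D where D: "integrable m D" and ae: "AE z in m. (cmod (gauss_series z))\<^sup>2 \<le> D z"
    using gauss_series_dominated[of 0] by (auto elim!: eventually_mono)
  show ?thesis
    by (rule Bochner_Integration.integrable_bound[OF D]) (use ae in \<open>auto elim!: eventually_mono\<close>)
qed

lemma gauss_series_L2_limit: "(\<lambda>K. \<integral>z. (cmod (gauss_series z - cinner (\<Sum>k<K. y k) z))\<^sup>2 \<partial>m) \<longlonglongrightarrow> 0"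
proof -
  obtain D where D: "integrable m D" and ae: "AE z in m. (\<lambda>K. \<Sum>k<K. cinner (y k) z) \<longlonglongrightarrow> gauss_series z
      \<and> (\<forall>K. (cmod (\<Sum>k<K. cinner (y k) z))\<^sup>2 \<le> D z) \<and> (cmod (gauss_series z))\<^sup>2 \<le> D z"
    using gauss_series_dominated[of 0] by blast
  have "(\<lambda>K. \<integral>z. (cmod (gauss_series z - cinner (\<Sum>k<K. y k) z))\<^sup>2 \<partial>m) \<longlonglongrightarrow> (\<integral>z. 0 \<partial>m)"
  proof (rule integral_dominated_convergence[where w="\<lambda>z. 4 * D z"])
    show "integrable m (\<lambda>z. 4 * D z)" using D by simp
    show "AE z in m. (\<lambda>K. (cmod (gauss_series z - cinner (\<Sum>k<K. y k) z))\<^sup>2) \<longlonglongrightarrow> 0"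
      using ae
    proof eventually_elim
      case (elim z)
      then have "(\<lambda>K. (cmod (gauss_series z - (\<Sum>k<K. cinner (y k) z)))\<^sup>2) \<longlonglongrightarrow> (cmod (gauss_series z - gauss_series z))\<^sup>2"
        by (intro tendsto_intros) simp
      then show ?case by (simp add: cinner_sum_left)
    qed
    show "AE z in m. norm ((cmod (gauss_series z - cinner (\<Sum>k<K. y k) z))\<^sup>2) \<le> 4 * D z" for K
      using ae
    proof eventually_elim
      case (elim z)
      have "(cmod (gauss_series z - (\<Sum>k<K. cinner (y k) z)))\<^sup>2 \<le> 2 * (cmod (gauss_series z))\<^sup>2 + 2 * (cmod (\<Sum>k<K. cinner (y k) z))\<^sup>2"
        by (rule norm_diff_square_le)
      also have "\<dots> \<le> 2 * D z + 2 * D z" using elim by (intro add_mono mult_left_mono) auto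
      also have "\<dots> = 4 * D z" by simp
      finally show ?case by (simp add: cinner_sum_left)
    qed
  qed simp_all
  then show ?thesis by simp
qed

lemma integral_gauss_series: "(\<integral>z. gauss_series z \<partial>m) = 0"
proof -
  obtain D where D: "integrable m D" and ae: "AE z in m. (\<lambda>K. \<Sum>k<K. cinner (y k) z) \<longlonglongrightarrow> gauss_series z
      \<and> (\<forall>K. (cmod (\<Sum>k<K. cinner (y k) z))\<^sup>2 \<le> D z) \<and> (cmod (gauss_series z))\<^sup>2 \<le> D z"
    using gauss_series_dominated[of 0] by blast
  have "(\<lambda>K. \<integral>z. (\<Sum>k<K. cinner (y k) z) \<partial>m) \<longlonglongrightarrow> (\<integral>z. gauss_series z \<partial>m)"
  proof (rule integral_dominated_convergence[where w="\<lambda>z. 1 + D z"])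
    show "integrable m (\<lambda>z. 1 + D z)" using D by simp
    show "AE z in m. norm (\<Sum>k<K. cinner (y k) z) \<le> 1 + D z" for K
      using ae
    proof eventually_elim
      case (elim z)
      have "t \<le> 1 + t\<^sup>2" for t :: real using zero_le_power2[of "t - 1 / 2"] by (simp add: power2_eq_square algebra_simps)
      from this[of "cmod (\<Sum>k<K. cinner (y k) z)"] show ?case using elim by (meson add_left_mono order_trans)
    qed
  qed (use ae in \<open>auto elim!: eventually_mono\<close>)
  moreover have "(\<integral>z. (\<Sum>k<K. cinner (y k) z) \<partial>m) = 0" for K
    by (simp add: integrable_cinner_m integral_cinner_m)
  ultimately show ?thesis by (simp add: LIMSEQ_const_iff)
qed

text \<open>For partial sums, moving \<open>T ^^ n\<close> to the adjoint and applying the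
  covariance identity gives the Fourier integral. Dominated convergence passes to the limit, and the
  product of means vanishes because the series has mean zero.\<close>

lemma gauss_series_correlation_limit:
  "(\<lambda>K. \<integral>l. cnj l ^ n * of_real ((cmod (cinner (\<Sum>k<K. y k) (E l)))\<^sup>2) \<partial>circle_measure)
     \<longlonglongrightarrow> I_n m T n (\<lambda>x. cnj (gauss_series x)) gauss_series"
proof -
  obtain D where D: "integrable m D" and ae: "AE z in m. (\<lambda>K. \<Sum>k<K. cinner (y k) z) \<longlonglongrightarrow> gauss_series z
      \<and> (\<forall>K. (cmod (\<Sum>k<K. cinner (y k) z))\<^sup>2 \<le> D z) \<and> (cmod (gauss_series z))\<^sup>2 \<le> D z"
    "AE z in m. (\<lambda>K. \<Sum>k<K. cinner (y k) ((T ^^ n) z)) \<longlonglongrightarrow> gauss_series ((T ^^ n) z)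
      \<and> (\<forall>K. (cmod (\<Sum>k<K. cinner (y k) ((T ^^ n) z)))\<^sup>2 \<le> D z)"
    using gauss_series_dominated[of n] by blast
  have "(\<lambda>K. \<integral>z. cnj (\<Sum>k<K. cinner (y k) ((T ^^ n) z)) * (\<Sum>k<K. cinner (y k) z) \<partial>m)
     \<longlonglongrightarrow> (\<integral>z. cnj (gauss_series ((T ^^ n) z)) * gauss_series z \<partial>m)"
  proof (rule integral_dominated_convergence[where w=D])
    show "AE z in m. (\<lambda>K. cnj (\<Sum>k<K. cinner (y k) ((T ^^ n) z)) * (\<Sum>k<K. cinner (y k) z)) \<longlonglongrightarrow> cnj (gauss_series ((T ^^ n) z)) * gauss_series z"
      using ae by eventually_elim (intro tendsto_intros, simp_all)
    show "AE z in m. norm (cnj (\<Sum>k<K. cinner (y k) ((T ^^ n) z)) * (\<Sum>k<K. cinner (y k) z)) \<le> D z" for K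
      using ae
    proof eventually_elim
      case (elim z)
      let ?a = "cmod (\<Sum>k<K. cinner (y k) ((T ^^ n) z))" and ?b = "cmod (\<Sum>k<K. cinner (y k) z)"
      have "2 * (?a * ?b) \<le> ?a\<^sup>2 + ?b\<^sup>2"
        using zero_le_power2[of "?a - ?b"] by (simp add: power2_eq_square algebra_simps)
      moreover have "?a\<^sup>2 \<le> D z" "?b\<^sup>2 \<le> D z" using elim by auto
      ultimately have "?a * ?b \<le> D z" by linarith
      then show ?case by (simp only: norm_mult complex_mod_cnj)
    qed
  qed (use D in simp_all)
  moreover have "(\<integral>z. cnj (\<Sum>k<K. cinner (y k) ((T ^^ n) z)) * (\<Sum>k<K. cinner (y k) z) \<partial>m)
     = (\<integral>l. cnj l ^ n * of_real ((cmod (cinner (\<Sum>k<K. y k) (E l)))\<^sup>2) \<partial>circle_measure)" for K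
  proof -
    define x where "x = (\<Sum>k<K. y k)"
    have "(\<integral>z. cnj (\<Sum>k<K. cinner (y k) ((T ^^ n) z)) * (\<Sum>k<K. cinner (y k) z) \<partial>m)
      = (\<integral>z. cinner x z * cnj (cinner ((S ^^ n) x) z) \<partial>m)"
      by (simp only: x_def cinner_sum_left[symmetric] cinner_S_funpow mult.commute)
    also have "\<dots> = (\<integral>l. cinner x (E l) * cnj (cinner ((S ^^ n) x) (E l)) \<partial>circle_measure)"
      by (simp only: covariance R)
    also have "\<dots> = (\<integral>l. cnj l ^ n * of_real ((cmod (cinner x (E l)))\<^sup>2) \<partial>circle_measure)"
      by (rule integral_circle_cong) (simp_all add: cinner_S_funpow_E complex_norm_square del: of_real_power)
    finally show ?thesis by (simp only: x_def)
  qed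
  moreover have "(\<integral>z. cnj (gauss_series ((T ^^ n) z)) * gauss_series z \<partial>m) = I_n m T n (\<lambda>x. cnj (gauss_series x)) gauss_series"
    by (simp add: I_n_def integral_gauss_series)
  ultimately show ?thesis by simp
qed

text \<open>Each partial sum of vectors is approximated in norm by a finite combination of basis
  vectors, and the L2(m) error is controlled through the bound on \<open>E\<close>.\<close>

lemma gauss_series_in_G_C:
  assumes e: "orthonormal_basis e"
  shows "gauss_series \<in> G_C m e"
proof -
  have "inj_on e {1..}"
  proof (rule inj_onI)
    fix i j :: nat assume ij: "i \<in> {1..}" "j \<in> {1..}" "e i = e j"
    have on: "cinner (e p) (e q) = (if p = q then 1 else 0)" if "p \<in> {1..}" "q \<in> {1..}" for p q
      using e that by (simp add: orthonormal_basis_def)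
    have "cinner (e i) (e i) = 1" using on[OF ij(1) ij(1)] by simp
    then have "(if i = j then 1 else 0 :: complex) = 1" using on[OF ij(1) ij(2)] unfolding ij(3) by simp
    then show "i = j" by (simp split: if_splits)
  qed
  then have span: "cinner v \<in> gauss_span e" if "v \<in> cspan (e ` {1..})" for v
  proof -
    from that obtain A c where A: "finite A" "A \<subseteq> e ` {1..}" and v: "v = (\<Sum>v\<in>A. cscale (c v) v)"
      by (auto simp: cspan_def)
    then obtain J where J: "J \<subseteq> {1..}" "A = e ` J" by (metis subset_image_iff)
    have inj: "inj_on e J" using \<open>inj_on e {1..}\<close> J(1) by (rule inj_on_subset)
    have "finite J" using A(1) J(2) inj finite_imageD by blast
    \<comment> \<open>The coefficients are conjugated because the inner product is conjugate-linear
      in its first argument.\<close>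
    moreover have "cinner v = (\<lambda>x. \<Sum>k\<in>J. cnj (c (e k)) * cinner (e k) x)"
      unfolding v J(2) sum.reindex[OF inj] by (simp add: fun_eq_iff cinner_sum_left cinner_cscale_left)
    ultimately show ?thesis using J(1) unfolding gauss_span_def
      by (intro CollectI exI[of _ J] exI[of _ "\<lambda>k. cnj (c (e k))"]) simp
  qed
  have "\<exists>v\<in>cspan (e ` {1..}). norm ((\<Sum>k<K. y k) - v) < 1 / (real K + 1)" for K
  proof -
    have "(\<Sum>k<K. y k) \<in> closure (cspan (e ` {1..}))" using e by (simp add: orthonormal_basis_def)
    moreover have "0 < 1 / (real K + 1)" by simp
    ultimately show ?thesis
      unfolding closure_approachable dist_norm norm_minus_commute[of "\<Sum>k<K. y k"] by blast
  qed
  then obtain v where v: "\<And>K. v K \<in> cspan (e ` {1..})" "\<And>K. norm ((\<Sum>k<K. y k) - v K) < 1 / (real K + 1)"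
    by metis
  \<comment> \<open>Twice the truncation error of the series plus twice the error of approximating
    the partial sum by \<open>v K\<close>.\<close>
  define b where "b K = 2 * (\<integral>z. (cmod (gauss_series z - cinner (\<Sum>k<K. y k) z))\<^sup>2 \<partial>m) + 2 * (1 / (real K + 1) * CE)\<^sup>2" for K
  have le: "(\<integral>z. (cmod (gauss_series z - cinner (v K) z))\<^sup>2 \<partial>m) \<le> b K" for K
  proof -
    let ?x = "\<Sum>k<K. y k"
    have i1: "integrable m (\<lambda>z. (cmod (gauss_series z - cinner x z))\<^sup>2)" for x
    proof (rule Bochner_Integration.integrable_bound[of _ "\<lambda>z. 2 * (cmod (gauss_series z))\<^sup>2 + 2 * (cmod (cinner x z))\<^sup>2"])
      show "integrable m (\<lambda>z. 2 * (cmod (gauss_series z))\<^sup>2 + 2 * (cmod (cinner x z))\<^sup>2)"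
        using integrable_gauss_series_square integrable_cinner_square_m by simp
      show "AE z in m. norm ((cmod (gauss_series z - cinner x z))\<^sup>2) \<le> norm (2 * (cmod (gauss_series z))\<^sup>2 + 2 * (cmod (cinner x z))\<^sup>2)"
        by (simp add: norm_diff_square_le)
    qed simp
    have "(\<integral>z. (cmod (gauss_series z - cinner (v K) z))\<^sup>2 \<partial>m)
       \<le> (\<integral>z. 2 * (cmod (gauss_series z - cinner ?x z))\<^sup>2 + 2 * (cmod (cinner (?x - v K) z))\<^sup>2 \<partial>m)"
    proof (rule integral_mono)
      show "(cmod (gauss_series z - cinner (v K) z))\<^sup>2 \<le> 2 * (cmod (gauss_series z - cinner ?x z))\<^sup>2 + 2 * (cmod (cinner (?x - v K) z))\<^sup>2" for z
        using norm_diff_square_le[of "gauss_series z - cinner ?x z" "cinner (v K) z - cinner ?x z"]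
        by (simp add: cinner_diff_left norm_minus_commute[of "cinner (v K) z"])
    qed (use i1 integrable_cinner_square_m in simp_all)
    also have "\<dots> = 2 * (\<integral>z. (cmod (gauss_series z - cinner ?x z))\<^sup>2 \<partial>m) + 2 * (\<integral>z. (cmod (cinner (?x - v K) z))\<^sup>2 \<partial>m)"
      using i1 integrable_cinner_square_m by simp
    also have "\<dots> \<le> b K"
    proof -
      have "(\<integral>z. (cmod (cinner (?x - v K) z))\<^sup>2 \<partial>m) \<le> (norm (?x - v K) * CE)\<^sup>2"
        by (rule integral_cinner_square_m_le)
      also have "\<dots> \<le> (1 / (real K + 1) * CE)\<^sup>2"
        using v(2)[of K] CE_nonneg by (intro power_mono mult_right_mono) auto
      finally show ?thesis by (simp add: b_def)
    qed
    finally show ?thesis .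
  qed
  have "(\<lambda>K. 1 / (real K + 1)) \<longlonglongrightarrow> 0"
    using LIMSEQ_inverse_real_of_nat by (simp add: inverse_eq_divide add.commute)
  then have "(\<lambda>K. 2 * (1 / (real K + 1) * CE)\<^sup>2) \<longlonglongrightarrow> 2 * (0 * CE)\<^sup>2"
    by (rule tendsto_mult[OF tendsto_const tendsto_power[OF tendsto_mult[OF _ tendsto_const]]])
  then have "b \<longlonglongrightarrow> 2 * 0 + 2 * (0 * CE)\<^sup>2"
    unfolding b_def[abs_def] by (rule tendsto_add[OF tendsto_mult_left[OF gauss_series_L2_limit]])
  then have b0: "b \<longlonglongrightarrow> 0" by simp
  have "(\<lambda>K. \<integral>z. (cmod (gauss_series z - cinner (v K) z))\<^sup>2 \<partial>m) \<longlonglongrightarrow> 0"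
    by (rule tendsto_sandwich[OF _ _ tendsto_const b0])
       (intro always_eventually allI integral_nonneg_AE zero_le_power2 le)+
  moreover have "gauss_series \<in> borel_measurable m" by simp
  ultimately show ?thesis
    unfolding G_C_def using integrable_gauss_series_square span[OF v(1)]
    by (intro CollectI conjI exI[of _ "\<lambda>K. cinner (v K)"] allI)
qed

end

end

section \<open>Existence of slowly decaying correlations\<close>

text \<open>Otherwise \<open>E\<close> is orthogonal to the whole basis, hence zero, on a set of
  full measure. The spanning hypothesis applied to that set would make the space trivial.\<close>

lemma exists_basis_vector_not_orthogonal:
  fixes E :: "complex \<Rightarrow> 'a::complex_hilbert"
  assumes infdim: "infinite_dimensional TYPE('a)" and e: "orthonormal_basis e" and span: "mu_spanning E"
    and meas [measurable]: "\<And>x. (\<lambda>l. cinner x (E l)) \<in> borel_measurable borel"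
    and C: "\<And>l. l \<in> circle \<Longrightarrow> norm (E l) \<le> C"
  shows "\<exists>k. (\<integral>l. (cmod (cinner (e k) (E l)))\<^sup>2 \<partial>circle_measure) > 0"
proof (rule ccontr)
  assume "\<not> ?thesis"
  then have le: "(\<integral>l. (cmod (cinner (e k) (E l)))\<^sup>2 \<partial>circle_measure) \<le> 0" for k by (simp add: not_less)
  have ae: "AE l in circle_measure. cinner (e k) (E l) = 0" for k
  proof -
    have "integrable circle_measure (\<lambda>l. (cmod (cinner (e k) (E l)))\<^sup>2)"
      by (rule integrable_circle[where B="(norm (e k) * C)\<^sup>2"])
         (auto intro!: power_mono order_trans[OF cinner_Cauchy_Schwarz] mult_left_mono C)
    moreover have "(\<integral>l. (cmod (cinner (e k) (E l)))\<^sup>2 \<partial>circle_measure) = 0"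
      using le[of k] by (intro antisym integral_nonneg_AE) auto
    ultimately have "AE l in circle_measure. (cmod (cinner (e k) (E l)))\<^sup>2 = 0"
      by (subst (asm) integral_nonneg_eq_0_iff_AE) auto
    then show ?thesis by simp
  qed
  define A where "A = {l \<in> circle. \<forall>k. cinner (e k) (E l) = 0}"
  have "A = circle \<inter> {l \<in> space borel. \<forall>k. cinner (e k) (E l) = 0}" by (auto simp: A_def)
  also have "\<dots> \<in> sets borel" by measurable
  finally have [measurable]: "A \<in> sets borel" .
  have "AE l in circle_measure. \<forall>k. cinner (e k) (E l) = 0" using ae by (simp add: AE_all_countable)
  then have "AE l in circle_measure. l \<in> A" using AE_circle by eventually_elim (simp add: A_def)
  then have "measure circle_measure A = 1" by (subst circle_measure.prob_eq_1) simp_all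
  then have "closure (cspan (E ` A)) = UNIV"
    using span unfolding mu_spanning_def by (auto simp: A_def)
  moreover have "E l = 0" if "l \<in> A" for l
  proof -
    have "cinner (E l) (E l) = 0"
    proof (rule cinner_eq_0_closure_cspan)
      show "closure (cspan (e ` {1..})) = UNIV" using e by (simp add: orthonormal_basis_def)
      show "cinner (E l) b = 0" if "b \<in> e ` {1..}" for b
        using that \<open>l \<in> A\<close> cinner_commute[of "E l" b] by (auto simp: A_def)
    qed
    then show ?thesis by (simp add: cinner_self_norm)
  qed
  then have "cspan (E ` A) \<subseteq> {0}"
    by (force simp: cspan_def intro!: sum.neutral)
  then have "closure (cspan (E ` A)) \<subseteq> {0}" by (rule closure_minimal) simp
  ultimately have "(UNIV :: 'a set) = {0}" by auto
  then have "cspan ({} :: 'a set) = UNIV" by (auto simp: cspan_def)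
  then show False using infdim unfolding infinite_dimensional_def by blast
qed

theorem theorem3p4:
  fixes T :: "'a::complex_hilbert \<Rightarrow> 'a"
    and E :: "complex \<Rightarrow> 'a"
    and R :: "'a \<Rightarrow> 'a"
    and m :: "'a measure"
    and e :: "nat \<Rightarrow> 'a"
    and s :: "nat \<Rightarrow> real"
  assumes sep: "separable_space TYPE('a)"
    and infdim: "infinite_dimensional TYPE('a)"
    and T_bdd: "bounded_clinear_op T"
    and E_field: "T_eigenvector_field T E"
    and E_meas: "\<forall>x. (\<lambda>l. cinner x (E l)) \<in> borel_measurable circle_measure"
    and E_span: "mu_spanning E"
    and R_def: "\<forall>x y. cinner (R x) y =
                   (\<integral>l. cinner x (E l) * cnj (cinner y (E l)) \<partial>circle_measure)"
    and m_gauss: "gaussian_measure_with_cov m R"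
    and e_onb: "orthonormal_basis e"
    and e_eig: "\<forall>k\<ge>1. \<exists>c. R (e k) = cscale c (e k)"
    and s_pos: "\<forall>n. s n > 0"
    and s_lim: "s \<longlonglongrightarrow> 0"
  shows "\<exists>f\<in>G_C m e. \<forall>n\<ge>1. cmod (I_n m T n (\<lambda>x. cnj (f x)) f) \<ge> s n"
proof -
  obtain S where S: "\<And>x z. cinner (S x) z = cinner x (T z)"
    by (rule adjoint_exists[OF T_bdd e_onb]) (rule that)
  obtain C where C: "\<And>l. l \<in> circle \<Longrightarrow> norm (E l) \<le> C"
    using E_field by (auto simp: T_eigenvector_field_def)
  have meas [measurable]: "(\<lambda>l. cinner x (E l)) \<in> borel_measurable borel" for x using E_meas by simp
  interpret gaussian_eigenfield T S E R m C
  proof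
    obtain K where K: "\<And>x. norm (T x) \<le> norm x * K" using T_bdd by (auto simp: bounded_clinear_op_def)
    have "bounded_linear T"
      by (rule bounded_linear_intro[of _ K])
         (use T_bdd K in \<open>auto simp: bounded_clinear_op_def cscale_of_real[symmetric]\<close>)
    then show "continuous_on UNIV T" by (rule bounded_linear.continuous_on) (rule continuous_on_id)
  qed (use S C E_field R_def m_gauss in \<open>auto simp: T_eigenvector_field_def\<close>)
  obtain k where pos: "(\<integral>l. (cmod (cinner (e k) (E l)))\<^sup>2 \<partial>circle_measure) > 0"
    using exists_basis_vector_not_orthogonal[OF infdim e_onb E_span meas C] by blast
  define x where "x = e k"
  define w where "w l = (cmod (cinner x (E l)))\<^sup>2" for l
  define B where "B = (norm x * C)\<^sup>2"
  have w_meas [measurable]: "w \<in> borel_measurable borel" unfolding w_def by measurable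
  have w: "0 \<le> w l" "w l \<le> B" if "l \<in> circle" for l
    using cinner_E_le[OF that, of x] by (auto simp: w_def B_def intro: power_mono)
  have wpos: "(\<integral>l. w l \<partial>circle_measure) > 0" using pos by (simp add: w_def x_def)
  obtain N v v0 \<alpha> where N: "\<And>i. N i > 0" and v: "\<And>i. v i \<in> circle" and v0: "v0 \<in> circle" and \<alpha>: "\<alpha> > 0"
    and lim0: "(\<lambda>i. \<integral>l. cmod (fejer_root (N i) (v i) l) \<partial>circle_measure) \<longlonglongrightarrow> 0"
    and limn: "\<And>n. (\<lambda>i. \<integral>l. cnj l ^ n * of_real ((cmod (fejer_root (N i) (v i) l))\<^sup>2 * w l) \<partial>circle_measure)
       \<longlonglongrightarrow> of_real \<alpha> * cnj v0 ^ n"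
    using concentrating_fejer_roots[OF w_meas w wpos] by blast
  define u where "u i = fejer_root (N i) (v i)" for i
  have u: "bdd_on_circle (u i)" for i
    unfolding bdd_on_circle_def u_def using fejer_root_bound[OF _ v] by auto
  have u_le: "(\<integral>l. (cmod (u i l))\<^sup>2 * w l \<partial>circle_measure) \<le> B" for i
  proof -
    have "integrable circle_measure (\<lambda>l. (cmod (u i l))\<^sup>2)"
      unfolding u_def by (rule integrable_circle[where B="(N i)\<^sup>2"]) (auto intro!: power_mono fejer_root_bound v)
    then have "(\<integral>l. (cmod (u i l))\<^sup>2 * w l \<partial>circle_measure) \<le> (\<integral>l. (cmod (u i l))\<^sup>2 * B \<partial>circle_measure)"
      by (intro integral_circle_mono integrable_autocorr(2)[OF w_meas w u])
         (auto intro!: mult_left_mono w)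
    also have "\<dots> = B" by (simp add: u_def integral_fejer_root_square[OF v N])
    finally show ?thesis .
  qed
  have "(\<lambda>i. \<integral>l. cmod (u i l) \<partial>circle_measure) \<longlonglongrightarrow> 0" using lim0 by (simp only: u_def)
  moreover have "(\<lambda>i. autocorr w n (u i)) \<longlonglongrightarrow> of_real \<alpha> * cnj v0 ^ n" for n
    using limn[of n] by (simp only: u_def autocorr_def)
  ultimately obtain i a C' where a: "\<And>k. \<bar>a k\<bar> \<le> C' / (real k + 1)\<^sup>2"
    and big: "\<And>n. \<forall>\<^sub>F K in sequentially. s n \<le> cmod (autocorr w n (\<lambda>l. \<Sum>k<K. of_real (a k) * u (i k) l))"
    using slowly_decaying_autocorr[of w B u \<alpha> v0 s, OF w_meas w u u_le _ _ \<alpha> v0 s_lim] by blast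
  \<comment> \<open>This is a_k times a polynomial in the adjoint applied to \<open>x\<close>.
    Conjugate-linearity turns the coefficients v^j / sqrt N into those of the kernel root, so <y k,
    E> is a_k u_i <x, E>.\<close>
  define y where "y k = a k *\<^sub>R (\<Sum>j<N (i k). cscale (v (i k) ^ j / of_real (sqrt (N (i k)))) ((S ^^ j) x))" for k
  have yE: "cinner (y k) (E l) = of_real (a k) * u (i k) l * cinner x (E l)" if "l \<in> circle" for k l
    by (simp add: y_def u_def fejer_root_def cinner_scaleR_left cinner_sum_left cinner_cscale_left cinner_S_funpow_E[OF that]
        scaleR_conv_of_real power_mult_distrib sum_divide_distrib sum_distrib_right sum_distrib_left ac_simps)
  \<comment> \<open>The decay of order 1/k^2 of the coefficients becomes, after squaring, the
    fourth-power decay required for the Gaussian series.\<close>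
  have y: "(\<integral>l. (cmod (cinner (y k) (E l)))\<^sup>2 \<partial>circle_measure) \<le> C'\<^sup>2 * B / (real k + 1) ^ 4" for k
  proof -
    have "(\<integral>l. (cmod (cinner (y k) (E l)))\<^sup>2 \<partial>circle_measure) = (\<integral>l. (a k)\<^sup>2 * ((cmod (u (i k) l))\<^sup>2 * w l) \<partial>circle_measure)"
      by (rule integral_circle_cong) (simp_all add: u_def yE[unfolded u_def] w_def norm_mult power_mult_distrib)
    also have "\<dots> = (a k)\<^sup>2 * (\<integral>l. (cmod (u (i k) l))\<^sup>2 * w l \<partial>circle_measure)" by simp
    also have "\<dots> \<le> (C' / (real k + 1)\<^sup>2)\<^sup>2 * B"
    proof (rule mult_mono)
      show "(a k)\<^sup>2 \<le> (C' / (real k + 1)\<^sup>2)\<^sup>2" using power_mono[OF a[of k], of 2] by simp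
      show "0 \<le> (\<integral>l. (cmod (u (i k) l))\<^sup>2 * w l \<partial>circle_measure)" by (intro integral_nonneg_AE) (simp add: w_def)
    qed (use u_le in auto)
    also have "\<dots> = C'\<^sup>2 * B / (real k + 1) ^ 4" by (simp add: power_divide flip: power_mult)
    finally show ?thesis .
  qed
  show ?thesis
  proof (intro bexI[of _ "gauss_series y"] allI impI)
    show "gauss_series y \<in> G_C m e" by (rule gauss_series_in_G_C[OF y e_onb])
    fix n :: nat
    have "(\<integral>l. cnj l ^ n * of_real ((cmod (cinner (\<Sum>k<K. y k) (E l)))\<^sup>2) \<partial>circle_measure)
      = autocorr w n (\<lambda>l. \<Sum>k<K. of_real (a k) * u (i k) l)" for K
      unfolding autocorr_def
    proof (rule integral_circle_cong)
      fix l assume l: "l \<in> circle"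
      have "cinner (\<Sum>k<K. y k) (E l) = (\<Sum>k<K. of_real (a k) * u (i k) l) * cinner x (E l)"
        by (simp add: cinner_sum_left yE[OF l] sum_distrib_right)
      then show "cnj l ^ n * of_real ((cmod (cinner (\<Sum>k<K. y k) (E l)))\<^sup>2)
         = cnj l ^ n * of_real ((cmod (\<Sum>k<K. of_real (a k) * u (i k) l))\<^sup>2 * w l)"
        by (simp add: w_def norm_mult power_mult_distrib)
    qed (simp_all add: u_def)
    then have "(\<lambda>K. autocorr w n (\<lambda>l. \<Sum>k<K. of_real (a k) * u (i k) l)) \<longlonglongrightarrow> I_n m T n (\<lambda>x. cnj (gauss_series y x)) (gauss_series y)"
      using gauss_series_correlation_limit[OF y, of n] by simp
    \<comment> \<open>For fixed \<open>n\<close> the lower bound holds for all large partial sums,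
      so it survives in the limit.\<close>
    then show "s n \<le> cmod (I_n m T n (\<lambda>x. cnj (gauss_series y x)) (gauss_series y))"
      by (intro tendsto_lowerbound[OF tendsto_norm big]) simp_all
  qed
qed

end
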